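(* Let $A$ be a real $m\times n$ matrix with $m\ge n>\max(k,2)$ and $\operatorname{rank}(A)=n$, let $A=U\Sigma V^T$ be its SVD with singular values $\sigma_1\ge\cdots\ge\sigma_n$, and let $q\ge0$, $0<k\le\ell<n$ and $0\le p\le\ell-k$ be integers. Let $\Omega$ be a real $n\times\ell$ matrix and partition $V^T\Omega=\begin{pmatrix}\widehat\Omega_1\\ \widehat\Omega_2\end{pmatrix}$, where $\widehat\Omega_1$ is $(\ell-p)\times\ell$ and $\widehat\Omega_2$ is $(n-\ell+p)\times\ell$. Assume that $\widehat\Omega_1$ has full row rank. Then the matrices $Q$ and $B_k$ computed by Basic Subspace Iteration with input $A,k,\ell,q,\Omega$ satisfy $$\|(I-QQ^T)A\|_F\le\|A-QB_k\|_F\le\sqrt{\Bigl(\sum_{j=k+1}^n\sigma_j^2\Bigr)+\frac{\alpha^2\|\widehat\Omega_2\|_2^2\|\widehat\Omega_1^\dagger\|_2^2}{1+\gamma^2\|\widehat\Omega_2\|_2^2\|\widehat\Omega_1^\dagger\|_2^2}},$$ $$\|(I-QQ^T)A\|_2\le\|A-QB_k\|_2\le\sqrt{\sigma_{k+1}^2+\frac{\alpha^2\|\widehat\Omega_2\|_2^2\|\widehat\Omega_1^\dagger\|_2^2}{1+\gamma^2\|\widehat\Omega_2\|_2^2\|\widehat\Omega_1^\dagger\|_2^2}},$$ where $$\alpha=\sqrt k\,\sigma_{\ell-p+1}\left(\frac{\sigma_{\ell-p+1}}{\sigma_k}\right)^{2q},\qquad \gamma=\left(\frac{\sigma_{\e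ll-p+1}}{\sigma_1}\right)\left(\frac{\sigma_{\ell-p+1}}{\sigma_k}\right)^{2q}.$$
   Context: $\|\cdot\|_2$ is the spectral norm, $\|\cdot\|_F$ the Frobenius norm, $X^\dagger$ is the Moore–Penrose pseudo-inverse. In the SVD, $U$ is $m\times n$ with orthonormal columns, $V$ is $n\times n$ orthogonal and $\Sigma=\mathrm{diag}(\sigma_1,\dots,\sigma_n)$. Basic Subspace Iteration (exact arithmetic): compute $Y=(AA^T)^qA\Omega$; compute a matrix $Q$ whose columns form an orthonormal basis of the column space of $Y$; compute $B=Q^TA$; let $B_k$ be the rank-$k$ truncated SVD of $B$ (keep only the $k$ largest singular values and the corresponding singular vectors); the output rank-$k$ approximation is $QB_k$. *)

theory Defs
  imports
    Complex_Main
    "Jordan_Normal_Form.VS_Connect"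
    "Jordan_Normal_Form.DL_Rank"
begin

(* Matrices are those of Jordan_Normal_Form, with entries indexed from 0.  Singular values
   are indexed from 1, as in the usual notation sigma_1, ..., sigma_d. *)

definition vec_2norm :: "real vec \<Rightarrow> real" where
  "vec_2norm v = sqrt (v \<bullet> v)"

(* The supremum runs over the closed unit ball, not the unit sphere, so that the set is
   nonempty also for matrices without columns. *)
definition spectral_norm :: "real mat \<Rightarrow> real" where
  "spectral_norm X =
     (SUP v \<in> {v \<in> carrier_vec (dim_col X). vec_2norm v \<le> 1}. vec_2norm (X *\<^sub>v v))"

definition frobenius_norm :: "real mat \<Rightarrow> real" where
  "frobenius_norm X = sqrt (\<Sum>i<dim_row X. \<Sum>j<dim_col X. (X $$ (i, j))\<^sup>2)"

definition orthonormal_cols :: "real mat \<Rightarrow> bool" where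
  "orthonormal_cols X \<longleftrightarrow> X\<^sup>T * X = 1\<^sub>m (dim_col X)"

definition is_pseudo_inverse :: "real mat \<Rightarrow> real mat \<Rightarrow> bool" where
  "is_pseudo_inverse X P \<longleftrightarrow>
     P \<in> carrier_mat (dim_col X) (dim_row X) \<and>
     X * P * X = X \<and> P * X * P = P \<and>
     (X * P)\<^sup>T = X * P \<and> (P * X)\<^sup>T = P * X"

definition pseudo_inverse :: "real mat \<Rightarrow> real mat" where
  "pseudo_inverse X = (THE P. is_pseudo_inverse X P)"

lemma is_pseudo_inverse_unique:
  assumes "is_pseudo_inverse X P" and "is_pseudo_inverse X R"
  shows "P = R"
proof -
  define a b where "a = dim_row X" and "b = dim_col X"
  have X: "X \<in> carrier_mat a b" by (simp add: a_def b_def)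
  have P: "P \<in> carrier_mat b a" and R: "R \<in> carrier_mat b a"
    and P1: "X * P * X = X" and R1: "X * R * X = X"
    and P2: "P * X * P = P" and R2: "R * X * R = R"
    and P3: "(X * P)\<^sup>T = X * P" and R3: "(X * R)\<^sup>T = X * R"
    and P4: "(P * X)\<^sup>T = P * X" and R4: "(R * X)\<^sup>T = R * X"
    using assms unfolding is_pseudo_inverse_def a_def b_def by auto
  have XP: "X * P \<in> carrier_mat a a" and XR: "X * R \<in> carrier_mat a a"
    and PX: "P * X \<in> carrier_mat b b" and RX: "R * X \<in> carrier_mat b b"
    using X P R by auto
  have "X * P = X * R * (X * P)"
    using R1 assoc_mult_mat[OF XR X P] by simp
  then have "X * P = (X * R * (X * P))\<^sup>T"
    using P3 by simp
  also have "\<dots> = X * P * (X * R)"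
    using transpose_mult[OF XR XP] P3 R3 by simp
  also have "\<dots> = X * R"
    using P1 assoc_mult_mat[OF XP X R] by simp
  finally have eq1: "X * P = X * R" .
  have "P * X = P * X * (R * X)"
    using R1 assoc_mult_mat[OF P X RX] assoc_mult_mat[OF X R X] by simp
  then have "P * X = (P * X * (R * X))\<^sup>T"
    using P4 by simp
  also have "\<dots> = R * X * (P * X)"
    using transpose_mult[OF PX RX] P4 R4 by simp
  also have "\<dots> = R * X"
    using P1 assoc_mult_mat[OF R X PX] assoc_mult_mat[OF X P X] by simp
  finally have eq2: "P * X = R * X" .
  have "P = R * X * P" using P2 eq2 by simp
  also have "\<dots> = R * (X * R)" using assoc_mult_mat[OF R X P] eq1 by simp
  also have "\<dots> = R" using assoc_mult_mat[OF R X R] R2 by simp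
  finally show ?thesis .
qed

lemma pseudo_inverse_eqI:
  assumes "is_pseudo_inverse X P"
  shows "pseudo_inverse X = P"
  unfolding pseudo_inverse_def using assms is_pseudo_inverse_unique by blast

(* Thin SVD of a matrix X of any shape, with d = min (rows, columns).  If X has at least as
   many rows as columns, then V is square and orthogonal; if it has at most as many rows as
   columns (the case of B = Q^T A below), then U is. *)
definition is_svd :: "real mat \<Rightarrow> real mat \<Rightarrow> (nat \<Rightarrow> real) \<Rightarrow> real mat \<Rightarrow> bool" where
  "is_svd X U \<sigma> V \<longleftrightarrow>
     (let d = min (dim_row X) (dim_col X) in
        U \<in> carrier_mat (dim_row X) d \<and> orthonormal_cols U \<and>
        V \<in> carrier_mat (dim_col X) d \<and> orthonormal_cols V \<and>
        (\<forall>i j. 1 \<le> i \<and> i \<le> j \<and> j \<le> d \<longrightarrow> \<sigma> j \<le> \<sigma> i) \<and>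
        (\<forall>i. 1 \<le> i \<and> i \<le> d \<longrightarrow> 0 \<le> \<sigma> i) \<and>
        X = U * mat_diag d (\<lambda>i. \<sigma> (Suc i)) * V\<^sup>T)"

definition first_cols :: "nat \<Rightarrow> real mat \<Rightarrow> real mat" where
  "first_cols k X = mat_of_cols (dim_row X) (take k (cols X))"

(* The truncation depends on the chosen SVD when the k-th and (k+1)-st singular values agree,
   hence a relation.  It is meant for k at most the number of rows and columns of X. *)
definition is_truncated_svd :: "nat \<Rightarrow> real mat \<Rightarrow> real mat \<Rightarrow> bool" where
  "is_truncated_svd k X X\<^sub>k \<longleftrightarrow>
     (\<exists>U \<sigma> V. is_svd X U \<sigma> V \<and>
        X\<^sub>k = first_cols k U * mat_diag k (\<lambda>i. \<sigma> (Suc i)) * (first_cols k V)\<^sup>T)"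

(* The number of columns of Q is the rank of Y, which may be smaller than the number of
   columns of Y. *)
definition is_orthonormal_basis_of_col_space :: "real mat \<Rightarrow> real mat \<Rightarrow> bool" where
  "is_orthonormal_basis_of_col_space Y Q \<longleftrightarrow>
     dim_row Q = dim_row Y \<and> orthonormal_cols Q \<and>
     vec_space.col_space (dim_row Y) Q = vec_space.col_space (dim_row Y) Y"

(* Q and B_k are possible results of Basic Subspace Iteration; the sample size l of the
   algorithm is the number of columns of Omega. *)
definition basic_subspace_iteration ::
  "real mat \<Rightarrow> nat \<Rightarrow> nat \<Rightarrow> real mat \<Rightarrow> real mat \<Rightarrow> real mat \<Rightarrow> bool" where
  "basic_subspace_iteration A k q \<Omega> Q B\<^sub>k \<longleftrightarrow>
     (\<exists>Y B. Y = (A * A\<^sup>T) ^\<^sub>m q * A * \<Omega> \<and>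
        is_orthonormal_basis_of_col_space Y Q \<and>
        B = Q\<^sup>T * A \<and>
        is_truncated_svd k B B\<^sub>k)"

end

theory Submission
  imports Defs
begin

text \<open>The output \<open>Q * B\<^sub>k\<close> is the orthogonal projection of \<open>A\<close> onto the range of \<open>Q * U\<^sub>k\<close>, where
\<open>U\<^sub>k\<close> holds the leading left singular vectors of \<open>B = Q\<^sup>T * A\<close> (lemma
\<open>truncated_svd_is_projection\<close>). This range is contained in that of \<open>Q\<close>, so projecting the error
\<open>A - Q * B\<^sub>k\<close> away from the range of \<open>Q\<close> leaves \<open>(I - Q * Q\<^sup>T) * A\<close>, and both lower bounds follow.

For the upper bound in the Frobenius norm, Pythagoras turns the squared error into \<open>|A|\<^sup>2\<close> minus
the sum of the \<open>k\<close> largest squared singular values of \<open>B\<close>. By Ky Fan's principle that sum is at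
least the energy captured by any subspace of the range of \<open>Q\<close> of dimension at most \<open>k\<close>. The
subspace to test is the following. Since \<open>\<Omega>\<^sub>1\<close> has the right inverse \<open>\<Omega>\<^sub>1\<^sup>\<dagger>\<close>, the range of \<open>Y\<close>
contains for each \<open>j \<le> k\<close> a vector \<open>g\<^sub>j\<close> that equals the left singular vector \<open>u\<^sub>j\<close> plus a
combination of the \<open>u\<^sub>i\<close> with \<open>i > l - p\<close>, and the power iteration damps this second part to
squared length at most \<open>\<omega>\<^sup>2 \<tau>\<^sub>j\<^sup>2\<close>. Here \<open>\<omega>\<close> is the product of the spectral norms of \<open>\<Omega>\<^sub>2\<close> and
\<open>\<Omega>\<^sub>1\<^sup>\<dagger>\<close>, and \<open>\<tau>\<^sub>j\<close> is the ratio of \<open>\<sigma>\<close> at index \<open>l - p + 1\<close> to \<open>\<sigma>\<^sub>j\<close>, to the power \<open>2q + 1\<close> (lemma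
\<open>sketch_vector_exists\<close>). Cauchy-Schwarz shows that the span of the \<open>g\<^sub>j\<close> captures at least
\<open>\<sigma>\<^sub>j\<^sup>2 / (1 + \<omega>\<^sup>2 \<tau>\<^sub>j\<^sup>2)\<close> for each \<open>j\<close> (lemma \<open>captured_energy_ge\<close>). The loss at each \<open>j\<close> is
bounded uniformly by one \<open>k\<close>-th of the second summand under the roots (lemma \<open>energy_loss_bound\<close>).

The spectral bound is deduced from the Frobenius bound. For \<open>v\<close> in the unit ball, deflating the
error \<open>E\<close> along \<open>v\<close> gives \<open>A\<close> minus a matrix of rank at most \<open>k + 1\<close>, whose squared norm is at
least the sum of the \<open>\<sigma>\<^sub>j\<^sup>2\<close> with \<open>j > k + 1\<close> by Eckart-Young. This leaves at most \<open>\<sigma>\<^sub>k\<^sub>+\<^sub>1\<^sup>2\<close>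
plus that summand for \<open>|E v|\<^sup>2\<close> (lemma \<open>low_rank_residual_mult_vec\<close>).\<close>

section \<open>Orthonormal columns and the Frobenius norm\<close>

lemma scalar_prod_self_ge_0: fixes v :: "real vec" shows "0 \<le> v \<bullet> v"
  unfolding scalar_prod_def by (intro sum_nonneg) auto

lemma real_scalar_prod_self_eq_0:
  fixes v :: "real vec"
  assumes "v \<in> carrier_vec n" "v \<bullet> v = 0"
  shows "v = 0\<^sub>v n"
proof -
  have "(\<Sum>i<n. (v $ i)\<^sup>2) = 0"
    using assms by (simp add: scalar_prod_def power2_eq_square lessThan_atLeast0)
  then show ?thesis using assms by (subst (asm) sum_nonneg_eq_0_iff) (auto intro!: eq_vecI)
qed

lemma scalar_prod_cauchy_schwarz:
  fixes x y :: "real vec"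
  assumes x: "x \<in> carrier_vec n" and y: "y \<in> carrier_vec n"
  shows "(x \<bullet> y)\<^sup>2 \<le> (x \<bullet> x) * (y \<bullet> y)"
proof (cases "y \<bullet> y = 0")
  case True
  then have "y = 0\<^sub>v n" by (rule real_scalar_prod_self_eq_0[OF y])
  then show ?thesis using x by simp
next
  case False
  then have pos: "0 < y \<bullet> y" using scalar_prod_self_ge_0[of y] by simp
  define c where "c = (x \<bullet> y) / (y \<bullet> y)"
  have cy: "c \<cdot>\<^sub>v y \<in> carrier_vec n" using y by simp
  have "0 \<le> (x - c \<cdot>\<^sub>v y) \<bullet> (x - c \<cdot>\<^sub>v y)" by (rule scalar_prod_self_ge_0)
  also have "\<dots> = x \<bullet> x - x \<bullet> (c \<cdot>\<^sub>v y) - ((c \<cdot>\<^sub>v y) \<bullet> x - (c \<cdot>\<^sub>v y) \<bullet> (c \<cdot>\<^sub>v y))"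
    unfolding minus_scalar_prod_distrib[OF x cy minus_carrier_vec[OF x cy]]
      scalar_prod_minus_distrib[OF x x cy] scalar_prod_minus_distrib[OF cy x cy] ..
  also have "\<dots> = x \<bullet> x - c * (x \<bullet> y)"
    using x y pos comm_scalar_prod[OF y x] by (simp add: c_def)
  finally show ?thesis using pos by (simp add: c_def power2_eq_square field_simps)
qed

lemma mult_mat_vec_adjoint:
  fixes X :: "real mat"
  assumes "X \<in> carrier_mat m n" "a \<in> carrier_vec n" "b \<in> carrier_vec m"
  shows "(X *\<^sub>v a) \<bullet> b = a \<bullet> (X\<^sup>T *\<^sub>v b)"
proof -
  have "X *\<^sub>v a \<in> carrier_vec m" "X\<^sup>T *\<^sub>v b \<in> carrier_vec n" using assms by auto
  then show ?thesis
    using transpose_vec_mult_scalar[OF assms(1-3)] comm_scalar_prod[of _ m b] comm_scalar_prod[of a n] assms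
    by metis
qed

text \<open>The squared Frobenius norm, taken column by column: every projection below acts on columns,
so identities for vectors sum up to identities for this quantity.\<close>

definition frob_sq :: "real mat \<Rightarrow> real" where
  "frob_sq X = (\<Sum>j<dim_col X. col X j \<bullet> col X j)"

lemma frob_sq_entries: "frob_sq X = (\<Sum>j<dim_col X. \<Sum>i<dim_row X. (X $$ (i, j))\<^sup>2)"
  unfolding frob_sq_def scalar_prod_def by (auto simp: power2_eq_square lessThan_atLeast0 intro!: sum.cong)

lemma frobenius_norm_eq_sqrt: "frobenius_norm X = sqrt (frob_sq X)"
  unfolding frobenius_norm_def frob_sq_entries by (subst sum.swap) simp

lemma frob_sq_ge_0: "0 \<le> frob_sq X"
  unfolding frob_sq_def by (intro sum_nonneg scalar_prod_self_ge_0)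

lemma frob_sq_transpose: "frob_sq X\<^sup>T = frob_sq X"
  unfolding frob_sq_entries by (subst sum.swap) simp

lemma orthonormal_cols_cancel:
  assumes "P \<in> carrier_mat m r" "orthonormal_cols P" "a \<in> carrier_vec r"
  shows "P\<^sup>T *\<^sub>v (P *\<^sub>v a) = a"
proof -
  have "P\<^sup>T *\<^sub>v (P *\<^sub>v a) = (P\<^sup>T * P) *\<^sub>v a"
    using assms by (intro assoc_mult_mat_vec[symmetric, of _ r m _ r]) auto
  also have "P\<^sup>T * P = 1\<^sub>m r" using assms by (simp add: orthonormal_cols_def)
  finally show ?thesis using assms by simp
qed

lemma orthonormal_cols_cancel_mat:
  assumes Q: "Q \<in> carrier_mat m r" "orthonormal_cols Q" and C: "C \<in> carrier_mat r n"
  shows "Q\<^sup>T * (Q * C) = C"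
proof -
  have "Q\<^sup>T * (Q * C) = Q\<^sup>T * Q * C" by (rule assoc_mult_mat[OF _ Q(1) C, symmetric]) (use Q in simp)
  also have "\<dots> = C" using Q C by (simp add: orthonormal_cols_def)
  finally show ?thesis .
qed

lemma orthonormal_cols_isometry:
  assumes "P \<in> carrier_mat m r" "orthonormal_cols P" "a \<in> carrier_vec r"
  shows "(P *\<^sub>v a) \<bullet> (P *\<^sub>v a) = a \<bullet> a"
  using assms mult_mat_vec_adjoint[of P m r a "P *\<^sub>v a"] orthonormal_cols_cancel[of P m r a] by auto

text \<open>\<open>P * P\<^sup>T\<close> is the orthogonal projector onto the range of \<open>P\<close>, so \<open>x\<close> splits into two
orthogonal parts, and the projected part has the same length as its coordinate vector \<open>P\<^sup>T *\<^sub>v x\<close>.\<close>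

lemma residual_pythagoras:
  assumes P: "P \<in> carrier_mat m r" "orthonormal_cols P" and x: "x \<in> carrier_vec m"
  shows "(x - P *\<^sub>v (P\<^sup>T *\<^sub>v x)) \<bullet> (x - P *\<^sub>v (P\<^sup>T *\<^sub>v x)) = x \<bullet> x - (P\<^sup>T *\<^sub>v x) \<bullet> (P\<^sup>T *\<^sub>v x)"
proof -
  define y where "y = P\<^sup>T *\<^sub>v x"
  have y: "y \<in> carrier_vec r" using P x by (auto simp: y_def)
  have Py: "P *\<^sub>v y \<in> carrier_vec m" using P y by auto
  have 1: "(P *\<^sub>v y) \<bullet> x = y \<bullet> y" using mult_mat_vec_adjoint[OF P(1) y x] by (simp add: y_def)
  have 2: "x \<bullet> (P *\<^sub>v y) = y \<bullet> y" using 1 comm_scalar_prod[OF x Py] by simp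
  have 3: "(P *\<^sub>v y) \<bullet> (P *\<^sub>v y) = y \<bullet> y" by (rule orthonormal_cols_isometry[OF P y])
  have "(x - P *\<^sub>v y) \<bullet> (x - P *\<^sub>v y) = x \<bullet> x - x \<bullet> (P *\<^sub>v y) - ((P *\<^sub>v y) \<bullet> x - (P *\<^sub>v y) \<bullet> (P *\<^sub>v y))"
    using x Py by (simp add: minus_scalar_prod_distrib[of _ m] scalar_prod_minus_distrib[of _ m])
  then show ?thesis using 1 2 3 by (simp add: y_def)
qed

lemma orthonormal_cols_bessel:
  assumes P: "P \<in> carrier_mat m r" "orthonormal_cols P" and x: "x \<in> carrier_vec m"
  shows "(P\<^sup>T *\<^sub>v x) \<bullet> (P\<^sup>T *\<^sub>v x) \<le> x \<bullet> x"
  using residual_pythagoras[OF assms] scalar_prod_self_ge_0[of "x - P *\<^sub>v (P\<^sup>T *\<^sub>v x)"] by simp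

lemma frob_sq_orthonormal_left:
  assumes P: "P \<in> carrier_mat m r" "orthonormal_cols P" and X: "X \<in> carrier_mat r c"
  shows "frob_sq (P * X) = frob_sq X"
proof -
  have "col (P * X) j \<bullet> col (P * X) j = col X j \<bullet> col X j" if "j < c" for j
    unfolding col_mult2[OF P(1) X that] by (rule orthonormal_cols_isometry[OF P]) (use X that in auto)
  then show ?thesis unfolding frob_sq_def using X by (intro sum.cong) auto
qed

lemma frob_sq_orthonormal_right:
  assumes P: "P \<in> carrier_mat c r" "orthonormal_cols P" and X: "X \<in> carrier_mat m r"
  shows "frob_sq (X * P\<^sup>T) = frob_sq X"
proof -
  have "frob_sq (X * P\<^sup>T) = frob_sq (P * X\<^sup>T)"
    by (subst frob_sq_transpose[symmetric], subst transpose_mult[of _ m r _ c]) (use assms in auto)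
  also have "\<dots> = frob_sq X" using frob_sq_orthonormal_left[OF P, of "X\<^sup>T" m] X by (simp add: frob_sq_transpose)
  finally show ?thesis .
qed

lemma frob_sq_residual:
  assumes P: "P \<in> carrier_mat m r" "orthonormal_cols P" and X: "X \<in> carrier_mat m c"
  shows "frob_sq (X - P * (P\<^sup>T * X)) = frob_sq X - frob_sq (P\<^sup>T * X)"
proof -
  have "col (X - P * (P\<^sup>T * X)) j = col X j - P *\<^sub>v (P\<^sup>T *\<^sub>v col X j)" "col (P\<^sup>T * X) j = P\<^sup>T *\<^sub>v col X j"
    if "j < c" for j
    using that P X col_mult2[of P m r "P\<^sup>T * X" c j] col_mult2[of "P\<^sup>T" r m X c j] by auto
  then show ?thesis unfolding frob_sq_def using P X
    by (simp add: sum_subtractf[symmetric]) (auto intro!: sum.cong residual_pythagoras)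
qed

section \<open>Optimality of leading singular subspaces\<close>

lemma orthonormal_cols_scalar_prod:
  assumes "U \<in> carrier_mat m d" "orthonormal_cols U" "i < d" "j < d"
  shows "col U i \<bullet> col U j = (if i = j then 1 else 0)"
proof -
  have "(U\<^sup>T * U) $$ (i, j) = (if i = j then 1 else 0)" using assms by (simp add: orthonormal_cols_def)
  then show ?thesis using assms by simp
qed

lemma orthonormal_cols_col_sq:
  assumes "U \<in> carrier_mat m d" "orthonormal_cols U" "i < d"
  shows "col U i \<bullet> col U i = 1"
  using orthonormal_cols_scalar_prod[OF assms assms(3)] by simp

lemma is_svdD:
  assumes svd: "is_svd X U \<sigma> V" and X: "X \<in> carrier_mat m n"
  shows "U \<in> carrier_mat m (min m n)" "orthonormal_cols U"
    and "V \<in> carrier_mat n (min m n)" "orthonormal_cols V"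
    and "X = U * mat_diag (min m n) (\<lambda>i. \<sigma> (Suc i)) * V\<^sup>T"
    and "\<And>i j. 1 \<le> i \<Longrightarrow> i \<le> j \<Longrightarrow> j \<le> min m n \<Longrightarrow> \<sigma> j \<le> \<sigma> i"
    and "\<And>i. 1 \<le> i \<Longrightarrow> i \<le> min m n \<Longrightarrow> 0 \<le> \<sigma> i"
  using svd unfolding is_svd_def Let_def carrier_matD[OF X] by blast+

text \<open>The factor \<open>V\<^sup>T\<close> on the right does not change the norm, and what is left has the columns
\<open>\<sigma>\<^sub>i P\<^sup>T u\<^sub>i\<close>. So the energy of \<open>X\<close> seen by \<open>P\<close> is a weighted sum of the squared singular values,
the weight of \<open>\<sigma>\<^sub>i\<^sup>2\<close> being the squared length of the projection of \<open>u\<^sub>i\<close>.\<close>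

lemma frob_sq_svd_compress:
  assumes svd: "is_svd X U \<sigma> V" and X: "X \<in> carrier_mat m n" and P: "P \<in> carrier_mat m r"
  shows "frob_sq (P\<^sup>T * X) =
    (\<Sum>i<min m n. (\<sigma> (Suc i))\<^sup>2 * ((P\<^sup>T *\<^sub>v col U i) \<bullet> (P\<^sup>T *\<^sub>v col U i)))"
proof -
  define d where "d = min m n"
  define D where "D = mat_diag d (\<lambda>i. \<sigma> (Suc i))"
  have U: "U \<in> carrier_mat m d" and V: "V \<in> carrier_mat n d" "orthonormal_cols V" and X_eq: "X = U * D * V\<^sup>T"
    by (fact is_svdD[OF svd X, folded d_def, folded D_def])+
  have D: "D \<in> carrier_mat d d" by (simp add: D_def)
  have "P\<^sup>T * X = P\<^sup>T * U * D * V\<^sup>T"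
    unfolding X_eq using P U V D
    by (simp add: assoc_mult_mat[of _ r m _ d _ d] assoc_mult_mat[of _ r m _ d _ n] assoc_mult_mat[of _ r d _ d _ n])
  then have "frob_sq (P\<^sup>T * X) = frob_sq (P\<^sup>T * U * D)"
    using frob_sq_orthonormal_right[OF V, of "P\<^sup>T * U * D" r] P U D by simp
  also have "\<dots> = (\<Sum>i<d. (\<sigma> (Suc i))\<^sup>2 * ((P\<^sup>T *\<^sub>v col U i) \<bullet> (P\<^sup>T *\<^sub>v col U i)))"
  proof -
    have "col (P\<^sup>T * U * D) i = \<sigma> (Suc i) \<cdot>\<^sub>v (P\<^sup>T *\<^sub>v col U i)" if "i < d" for i
      using that P U unfolding D_def
      by (subst mat_diag_mult_right[of _ r d]) (auto intro!: eq_vecI)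
    then show ?thesis unfolding frob_sq_def using P U D
      by (auto intro!: sum.cong simp: power2_eq_square)
  qed
  finally show ?thesis by (simp add: d_def)
qed

lemma frob_sq_svd:
  assumes svd: "is_svd X U \<sigma> V" and X: "X \<in> carrier_mat m n"
  shows "frob_sq X = (\<Sum>i<min m n. (\<sigma> (Suc i))\<^sup>2)"
proof -
  have U: "U \<in> carrier_mat m (min m n)" "orthonormal_cols U" by (rule is_svdD[OF svd X])+
  have "frob_sq X = frob_sq ((1\<^sub>m m)\<^sup>T * X)" using X by simp
  also have "\<dots> = (\<Sum>i<min m n. (\<sigma> (Suc i))\<^sup>2 * (((1\<^sub>m m)\<^sup>T *\<^sub>v col U i) \<bullet> ((1\<^sub>m m)\<^sup>T *\<^sub>v col U i)))"
    by (rule frob_sq_svd_compress[OF svd X, of _ m]) simp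
  also have "\<dots> = (\<Sum>i<min m n. (\<sigma> (Suc i))\<^sup>2)"
    using U by (intro sum.cong) (auto simp: orthonormal_cols_col_sq[OF U])
  finally show ?thesis .
qed

lemma frob_sq_orthonormal_cols:
  assumes "P \<in> carrier_mat m r" "orthonormal_cols P"
  shows "frob_sq P = real r"
  unfolding frob_sq_def using assms by (simp add: orthonormal_cols_col_sq[OF assms])

text \<open>The weights add up to the squared Frobenius norm of \<open>P\<^sup>T * U\<close>. Seen from the other side,
this is the sum of the squared lengths of the columns of \<open>P\<close> after projection by \<open>U\<close>, and each
column has length 1.\<close>

lemma sum_compressed_cols_le:
  assumes P: "P \<in> carrier_mat m r" "orthonormal_cols P" and U: "U \<in> carrier_mat m d" "orthonormal_cols U"
  shows "(\<Sum>i<d. (P\<^sup>T *\<^sub>v col U i) \<bullet> (P\<^sup>T *\<^sub>v col U i)) \<le> real r"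
proof -
  have "(\<Sum>i<d. (P\<^sup>T *\<^sub>v col U i) \<bullet> (P\<^sup>T *\<^sub>v col U i)) = frob_sq (P\<^sup>T * U)"
  proof -
    have "col (P\<^sup>T * U) i = P\<^sup>T *\<^sub>v col U i" if "i < d" for i
      by (rule col_mult2[OF _ U(1) that]) (use P in simp)
    then show ?thesis unfolding frob_sq_def using U by (intro sum.cong) auto
  qed
  also have "\<dots> = frob_sq (U\<^sup>T * P)"
    by (subst frob_sq_transpose[symmetric], subst transpose_mult[of _ r m _ d]) (use P U in auto)
  also have "\<dots> \<le> frob_sq P" 
    using frob_sq_residual[OF U P(1)] frob_sq_ge_0[of "P - U * (U\<^sup>T * P)"] by simp
  also have "\<dots> = real r" by (rule frob_sq_orthonormal_cols[OF P])
  finally show ?thesis .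
qed

text \<open>Moving weight from large indices to small ones can only increase the sum. Comparing every
term with the pivot \<open>a k\<close> makes this precise: below \<open>k\<close> the weights fall short of 1, above \<open>k\<close>
they exceed 0, and the total shortfall is at least the total excess.\<close>

lemma weighted_sum_le_sum_first:
  fixes a w :: "nat \<Rightarrow> real"
  assumes anti: "\<And>i j. i \<le> j \<Longrightarrow> j < d \<Longrightarrow> a j \<le> a i" and nonneg: "\<And>i. i < d \<Longrightarrow> 0 \<le> a i"
    and w: "\<And>i. i < d \<Longrightarrow> 0 \<le> w i" "\<And>i. i < d \<Longrightarrow> w i \<le> 1" and sum: "(\<Sum>i<d. w i) \<le> real k"
    and k: "k \<le> d"
  shows "(\<Sum>i<d. a i * w i) \<le> (\<Sum>i<k. a i)"
proof (cases "k = d")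
  case True
  then show ?thesis using nonneg w by (auto intro!: sum_mono mult_left_le)
next
  case False
  then have kd: "k < d" using k by simp
  have split: "(\<Sum>i<d. f i) = (\<Sum>i<k. f i) + (\<Sum>i=k..<d. f i)" for f :: "nat \<Rightarrow> real"
    using k by (metis sum.atLeastLessThan_concat lessThan_atLeast0 le0)
  have "(\<Sum>i<k. a i * (1 - w i)) \<ge> (\<Sum>i<k. a k * (1 - w i))"
    using anti w kd by (intro sum_mono mult_right_mono) auto
  moreover have "(\<Sum>i=k..<d. a i * w i) \<le> (\<Sum>i=k..<d. a k * w i)"
    using anti w kd by (intro sum_mono mult_right_mono) auto
  moreover have "(\<Sum>i<k. a k * (1 - w i)) - (\<Sum>i=k..<d. a k * w i) = a k * (real k - (\<Sum>i<d. w i))"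
    unfolding split[of w] by (simp add: sum_distrib_left[symmetric] sum_subtractf algebra_simps)
  moreover have "0 \<le> a k * (real k - (\<Sum>i<d. w i))" using nonneg kd sum by simp
  ultimately show ?thesis unfolding split[of "\<lambda>i. a i * w i"] by (simp add: algebra_simps sum_subtractf)
qed

text \<open>Ky Fan's maximum principle: among all subspaces of dimension at most \<open>k\<close>, the leading left
singular vectors capture the most energy. It is used for \<open>A\<close> itself (through the next lemma) and
for the compressed matrix \<open>B = Q\<^sup>T * A\<close>.\<close>

lemma ky_fan:
  assumes svd: "is_svd X U \<sigma> V" and X: "X \<in> carrier_mat m n"
    and P: "P \<in> carrier_mat m r" "orthonormal_cols P" and "r \<le> k" "k \<le> min m n"
  shows "frob_sq (P\<^sup>T * X) \<le> (\<Sum>i<k. (\<sigma> (Suc i))\<^sup>2)"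
proof -
  have U: "U \<in> carrier_mat m (min m n)" "orthonormal_cols U"
    and \<sigma>: "\<And>i j. 1 \<le> i \<Longrightarrow> i \<le> j \<Longrightarrow> j \<le> min m n \<Longrightarrow> \<sigma> j \<le> \<sigma> i" "\<And>i. 1 \<le> i \<Longrightarrow> i \<le> min m n \<Longrightarrow> 0 \<le> \<sigma> i"
    by (fact is_svdD[OF svd X])+
  show ?thesis unfolding frob_sq_svd_compress[OF svd X P(1)]
  proof (rule weighted_sum_le_sum_first)
    show "(P\<^sup>T *\<^sub>v col U i) \<bullet> (P\<^sup>T *\<^sub>v col U i) \<le> 1" if "i < min m n" for i
      using orthonormal_cols_bessel[OF P, of "col U i"] orthonormal_cols_col_sq[OF U that] that U by simp
    show "(\<Sum>i<min m n. (P\<^sup>T *\<^sub>v col U i) \<bullet> (P\<^sup>T *\<^sub>v col U i)) \<le> real k"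
      using sum_compressed_cols_le[OF P U] \<open>r \<le> k\<close> by linarith
  qed (use \<sigma> assms in \<open>auto intro!: power_mono scalar_prod_self_ge_0\<close>)
qed

text \<open>The Eckart-Young lower bound. The rank condition on \<open>C\<close> is expressed by an orthonormal \<open>P\<close>
with few columns whose range contains the columns of \<open>C\<close>; projecting \<open>X - C\<close> away from that range
removes \<open>C\<close> altogether and leaves a residual of \<open>X\<close>, which Ky Fan's principle bounds from below.\<close>

lemma eckart_young_frob:
  assumes svd: "is_svd X U \<sigma> V" and X: "X \<in> carrier_mat m n" and C: "C \<in> carrier_mat m n"
    and P: "P \<in> carrier_mat m r" "orthonormal_cols P" and "r \<le> k" "k \<le> min m n"
    and fix_C: "P * (P\<^sup>T * C) = C"
  shows "(\<Sum>i=k..<min m n. (\<sigma> (Suc i))\<^sup>2) \<le> frob_sq (X - C)"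
proof -
  have XC: "X - C \<in> carrier_mat m n" using C by (rule minus_carrier_mat)
  have "X - C - P * (P\<^sup>T * (X - C)) = X - C - (P * (P\<^sup>T * X) - C)"
    using P X C fix_C by (simp add: mult_minus_distrib_mat[of _ r m _ n] mult_minus_distrib_mat[of _ m r _ n])
  also have "\<dots> = X - P * (P\<^sup>T * X)" using P X C by (intro eq_matI) auto
  finally have eq: "X - C - P * (P\<^sup>T * (X - C)) = X - P * (P\<^sup>T * X)" .
  have "(\<Sum>i<min m n. (\<sigma> (Suc i))\<^sup>2) = (\<Sum>i<k. (\<sigma> (Suc i))\<^sup>2) + (\<Sum>i=k..<min m n. (\<sigma> (Suc i))\<^sup>2)"
    using \<open>k \<le> min m n\<close> by (metis sum.atLeastLessThan_concat lessThan_atLeast0 le0)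
  then have "(\<Sum>i=k..<min m n. (\<sigma> (Suc i))\<^sup>2) \<le> frob_sq X - frob_sq (P\<^sup>T * X)"
    using ky_fan[OF svd X P \<open>r \<le> k\<close> \<open>k \<le> min m n\<close>] frob_sq_svd[OF svd X] by simp
  also have "\<dots> = frob_sq (X - C) - frob_sq (P\<^sup>T * (X - C))"
    using frob_sq_residual[OF P X] frob_sq_residual[OF P XC] eq by simp
  finally show ?thesis using frob_sq_ge_0[of "P\<^sup>T * (X - C)"] by simp
qed

text \<open>Gram-Schmidt. The number of columns may be smaller than the length of the list, since the
vectors may be dependent: a vector already in the span adds no column.\<close>

lemma orthonormal_basis_exists:
  assumes "set vs \<subseteq> carrier_vec m"
  shows "\<exists>P r. r \<le> length vs \<and> P \<in> carrier_mat m r \<and> orthonormal_cols P \<and>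
    (\<forall>v\<in>set vs. P *\<^sub>v (P\<^sup>T *\<^sub>v v) = v)"
  using assms
proof (induction vs)
  case Nil
  show ?case by (intro exI[of _ "0\<^sub>m m 0"] exI[of _ "0::nat"]) (auto simp: orthonormal_cols_def intro!: eq_matI)
next
  case (Cons v vs)
  then obtain P r where P: "r \<le> length vs" "P \<in> carrier_mat m r" "orthonormal_cols P"
    "\<And>v. v \<in> set vs \<Longrightarrow> P *\<^sub>v (P\<^sup>T *\<^sub>v v) = v" by auto
  have v: "v \<in> carrier_vec m" using Cons by auto
  define w where "w = v - P *\<^sub>v (P\<^sup>T *\<^sub>v v)"
  have w: "w \<in> carrier_vec m" using v P by (auto simp: w_def)
  show ?case
  proof (cases "w = 0\<^sub>v m")
    case True
    have "P *\<^sub>v (P\<^sup>T *\<^sub>v v) = v"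
    proof (rule eq_vecI)
      fix i assume "i < dim_vec v"
      moreover have "w $ i = 0" using True calculation v by simp
      ultimately show "(P *\<^sub>v (P\<^sup>T *\<^sub>v v)) $ i = v $ i" using v P by (simp add: w_def)
    qed (use P v in auto)
    then show ?thesis using P by (intro exI[of _ P] exI[of _ r]) auto
  next
    case False
    have wpos: "w \<bullet> w > 0"
    proof -
      obtain i where i: "i < m" "w $ i \<noteq> 0" using False w by (metis carrier_vecD eq_vecI index_zero_vec)
      have "0 < (w $ i)\<^sup>2" using i by simp
      also have "\<dots> \<le> (\<Sum>i<m. (w $ i)\<^sup>2)" using i by (intro member_le_sum) auto
      also have "\<dots> = w \<bullet> w" using w by (simp add: scalar_prod_def power2_eq_square lessThan_atLeast0)
      finally show ?thesis .
    qed
    define u where "u = (1 / sqrt (w \<bullet> w)) \<cdot>\<^sub>v w"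
    have u: "u \<in> carrier_vec m" using w by (simp add: u_def)
    have Ptw: "P\<^sup>T *\<^sub>v w = 0\<^sub>v r"
      unfolding w_def using P v orthonormal_cols_cancel[OF P(2,3), of "P\<^sup>T *\<^sub>v v"]
      by (subst mult_minus_distrib_mat_vec[of _ r m]) auto
    have Ptu: "P\<^sup>T *\<^sub>v u = 0\<^sub>v r"
      unfolding u_def using P w by (subst mult_mat_vec[of _ r m]) (auto simp: Ptw)
    have uu: "u \<bullet> u = 1" using wpos w by (simp add: u_def real_sqrt_mult_self)
    have uP: "col P j \<bullet> u = 0" "u \<bullet> col P j = 0" if "j < r" for j
    proof -
      have "(P\<^sup>T *\<^sub>v u) $ j = 0" using Ptu that by simp
      then show "col P j \<bullet> u = 0" using that P by simp
      then show "u \<bullet> col P j = 0" using comm_scalar_prod[of u m "col P j"] u P that by auto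
    qed
    \<comment> \<open>append the normalised component of \<open>v\<close> orthogonal to the range of \<open>P\<close> as a further column\<close>
    define P' where "P' = mat m (Suc r) (\<lambda>(i,j). if j < r then P $$ (i,j) else u $ i)"
    have P': "P' \<in> carrier_mat m (Suc r)" by (simp add: P'_def)
    have colP': "col P' j = (if j < r then col P j else u)" if "j < Suc r" for j
      using that P u by (intro eq_vecI) (auto simp: P'_def)
    have PtP: "col P i \<bullet> col P j = (if i = j then 1 else 0)" if "i < r" "j < r" for i j
    proof -
      have "(P\<^sup>T * P) $$ (i, j) = (if i = j then 1 else 0)" using that P by (simp add: orthonormal_cols_def)
      then show ?thesis using that P by simp
    qed
    have orth: "orthonormal_cols P'"
      unfolding orthonormal_cols_def
      by (rule eq_matI) (use P' in \<open>auto simp: colP' PtP uP uu less_Suc_eq\<close>)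
    have app: "P' *\<^sub>v (P'\<^sup>T *\<^sub>v x) = P *\<^sub>v (P\<^sup>T *\<^sub>v x) + (u \<bullet> x) \<cdot>\<^sub>v u" if x: "x \<in> carrier_vec m" for x
    proof (rule eq_vecI)
      fix i assume "i < dim_vec (P *\<^sub>v (P\<^sup>T *\<^sub>v x) + (u \<bullet> x) \<cdot>\<^sub>v u)"
      then have i: "i < m" using u by simp
      have "(P' *\<^sub>v (P'\<^sup>T *\<^sub>v x)) $ i = (\<Sum>j<Suc r. P' $$ (i,j) * (col P' j \<bullet> x))"
        using i P' by (auto simp: scalar_prod_def[of "row P' i"] lessThan_atLeast0 simp del: sum.atLeast0_lessThan_Suc intro!: sum.cong)
      also have "\<dots> = (\<Sum>j<r. P $$ (i,j) * (col P j \<bullet> x)) + u $ i * (u \<bullet> x)"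
        using i by (simp add: colP') (simp add: P'_def)
      also have "(\<Sum>j<r. P $$ (i,j) * (col P j \<bullet> x)) = (P *\<^sub>v (P\<^sup>T *\<^sub>v x)) $ i"
        using i P by (auto simp: scalar_prod_def[of "row P i"] lessThan_atLeast0 intro!: sum.cong)
      finally show "(P' *\<^sub>v (P'\<^sup>T *\<^sub>v x)) $ i = (P *\<^sub>v (P\<^sup>T *\<^sub>v x) + (u \<bullet> x) \<cdot>\<^sub>v u) $ i"
        using i u P by simp
    qed (use P' u in auto)
    have old: "P' *\<^sub>v (P'\<^sup>T *\<^sub>v x) = x" if x: "x \<in> carrier_vec m" "P *\<^sub>v (P\<^sup>T *\<^sub>v x) = x" for x
    proof -
      have y: "P\<^sup>T *\<^sub>v x \<in> carrier_vec r" using P x by simp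
      have "u \<bullet> x = (P *\<^sub>v (P\<^sup>T *\<^sub>v x)) \<bullet> u" using x comm_scalar_prod[OF u x(1)] by simp
      also have "\<dots> = 0" using mult_mat_vec_adjoint[OF P(2) y u] Ptu y by simp
      finally show ?thesis using app[OF x(1)] x u by auto
    qed
    have "(u \<bullet> v) \<cdot>\<^sub>v u = w"
    proof -
      have y: "P\<^sup>T *\<^sub>v v \<in> carrier_vec r" using P v by simp
      have "(P *\<^sub>v (P\<^sup>T *\<^sub>v v)) \<bullet> w = 0" using mult_mat_vec_adjoint[OF P(2) y w] Ptw y by simp
      then have "w \<bullet> w = v \<bullet> w" 
        using minus_scalar_prod_distrib[of v m "P *\<^sub>v (P\<^sup>T *\<^sub>v v)" w] v w y P by (simp add: w_def[symmetric])
      then have "u \<bullet> v = sqrt (w \<bullet> w)"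
        using comm_scalar_prod[OF w v] v w wpos by (simp add: u_def real_div_sqrt)
      then show ?thesis using wpos w by (auto simp: u_def smult_smult_assoc)
    qed
    then have "P' *\<^sub>v (P'\<^sup>T *\<^sub>v v) = v"
      using app[OF v] v P by (auto simp: w_def intro!: eq_vecI)
    then show ?thesis using P P' orth old Cons.prems
      by (intro exI[of _ P'] exI[of _ "Suc r"]) auto
  qed
qed

section \<open>The spectral norm\<close>

definition outer_prod :: "real vec \<Rightarrow> real vec \<Rightarrow> real mat" where
  "outer_prod g v = mat (dim_vec g) (dim_vec v) (\<lambda>(i, j). g $ i * v $ j)"

text \<open>Removing from \<open>E\<close> the rank-one matrix that agrees with \<open>E\<close> on a unit vector \<open>v\<close> lowers the
squared norm by exactly \<open>|E v|\<^sup>2\<close>. The identity is stated for all \<open>v\<close>, which spares normalising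
vectors of the unit ball.\<close>

lemma frob_sq_deflate:
  assumes E: "E \<in> carrier_mat m n" and v: "v \<in> carrier_vec n"
  shows "frob_sq (E - outer_prod (E *\<^sub>v v) v) =
    frob_sq E - 2 * ((E *\<^sub>v v) \<bullet> (E *\<^sub>v v)) + ((E *\<^sub>v v) \<bullet> (E *\<^sub>v v)) * (v \<bullet> v)"
proof -
  define g where "g = E *\<^sub>v v"
  have g: "g \<in> carrier_vec m" using E v by (simp add: g_def)
  have gi: "g $ i = (\<Sum>j<n. E $$ (i,j) * v $ j)" if "i < m" for i
    using that E v by (auto simp: g_def scalar_prod_def lessThan_atLeast0 intro!: sum.cong)
  have gg: "g \<bullet> g = (\<Sum>i<m. g $ i * g $ i)" and vv: "v \<bullet> v = (\<Sum>j<n. v $ j * v $ j)"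
    using g v by (simp_all add: scalar_prod_def lessThan_atLeast0)
  have "frob_sq (E - outer_prod g v) = (\<Sum>j<n. \<Sum>i<m. (E $$ (i,j) - g $ i * v $ j)\<^sup>2)"
    using E g v by (auto simp: frob_sq_entries outer_prod_def intro!: sum.cong)
  also have "\<dots> = (\<Sum>j<n. \<Sum>i<m. (E $$ (i,j))\<^sup>2) - 2 * (\<Sum>j<n. \<Sum>i<m. g $ i * (E $$ (i,j) * v $ j))
      + (\<Sum>j<n. \<Sum>i<m. (g $ i * g $ i) * (v $ j * v $ j))"
  proof -
    have "(E $$ (i,j) - g $ i * v $ j)\<^sup>2 =
        (E $$ (i,j))\<^sup>2 - 2 * (g $ i * (E $$ (i,j) * v $ j)) + (g $ i * g $ i) * (v $ j * v $ j)" for i j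
      by (simp add: power2_eq_square algebra_simps)
    then show ?thesis by (simp only: sum.distrib sum_subtractf sum_distrib_left[symmetric])
  qed
  also have "(\<Sum>j<n. \<Sum>i<m. g $ i * (E $$ (i,j) * v $ j)) = g \<bullet> g"
    by (subst sum.swap) (simp add: gg sum_distrib_left[symmetric] gi)
  also have "(\<Sum>j<n. \<Sum>i<m. (g $ i * g $ i) * (v $ j * v $ j)) = (g \<bullet> g) * (v \<bullet> v)"
    by (subst sum.swap) (simp add: gg vv sum_product)
  also have "(\<Sum>j<n. \<Sum>i<m. (E $$ (i,j))\<^sup>2) = frob_sq E" using E by (simp add: frob_sq_entries)
  finally show ?thesis by (simp add: g_def)
qed

lemma frob_sq_deflate_le:
  assumes E: "E \<in> carrier_mat m n" and v: "v \<in> carrier_vec n" "v \<bullet> v \<le> 1"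
  shows "frob_sq (E - outer_prod (E *\<^sub>v v) v) \<le> frob_sq E - (E *\<^sub>v v) \<bullet> (E *\<^sub>v v)"
  using frob_sq_deflate[OF E v(1)] mult_left_mono[OF v(2) scalar_prod_self_ge_0[of "E *\<^sub>v v"]] by simp

lemma vec_2norm_le_1: "vec_2norm v \<le> 1 \<longleftrightarrow> v \<bullet> v \<le> 1"
  by (simp add: vec_2norm_def)

text \<open>The supremum in the spectral norm is one over a bounded set, as the Frobenius norm is an
upper bound: a deflated matrix has nonnegative norm.\<close>

lemma spectral_norm_bdd:
  "bdd_above ((\<lambda>v. vec_2norm (X *\<^sub>v v)) ` {v \<in> carrier_vec (dim_col X). vec_2norm v \<le> 1})"
proof (rule bdd_aboveI2)
  fix v assume "v \<in> {v \<in> carrier_vec (dim_col X). vec_2norm v \<le> 1}"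
  then have "v \<in> carrier_vec (dim_col X)" "v \<bullet> v \<le> 1" by (auto simp: vec_2norm_le_1)
  then have "(X *\<^sub>v v) \<bullet> (X *\<^sub>v v) \<le> frob_sq X"
    using frob_sq_deflate_le[of X "dim_row X" "dim_col X" v] frob_sq_ge_0[of "X - outer_prod (X *\<^sub>v v) v"]
    by simp
  then show "vec_2norm (X *\<^sub>v v) \<le> sqrt (frob_sq X)" by (simp add: vec_2norm_def)
qed

lemma zero_in_unit_ball: "0\<^sub>v n \<in> {v \<in> carrier_vec n. vec_2norm v \<le> 1}"
  by (simp add: vec_2norm_def)

lemma spectral_norm_leI:
  assumes "\<And>v. v \<in> carrier_vec (dim_col X) \<Longrightarrow> v \<bullet> v \<le> 1 \<Longrightarrow> (X *\<^sub>v v) \<bullet> (X *\<^sub>v v) \<le> c"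
  shows "spectral_norm X \<le> sqrt c"
  unfolding spectral_norm_def
proof (rule cSUP_least)
  show "{v \<in> carrier_vec (dim_col X). vec_2norm v \<le> 1} \<noteq> {}" using zero_in_unit_ball by blast
qed (use assms in \<open>auto simp: vec_2norm_le_1, auto simp: vec_2norm_def\<close>)

lemma spectral_norm_mono:
  assumes "dim_col X = dim_col Y"
    and "\<And>v. v \<in> carrier_vec (dim_col X) \<Longrightarrow> (X *\<^sub>v v) \<bullet> (X *\<^sub>v v) \<le> (Y *\<^sub>v v) \<bullet> (Y *\<^sub>v v)"
  shows "spectral_norm X \<le> spectral_norm Y"
  unfolding spectral_norm_def
proof (rule cSUP_mono)
  show "{v \<in> carrier_vec (dim_col X). vec_2norm v \<le> 1} \<noteq> {}" using zero_in_unit_ball by blast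
  show "\<exists>w\<in>{v \<in> carrier_vec (dim_col Y). vec_2norm v \<le> 1}. vec_2norm (X *\<^sub>v v) \<le> vec_2norm (Y *\<^sub>v w)"
    if "v \<in> {v \<in> carrier_vec (dim_col X). vec_2norm v \<le> 1}" for v
    using that assms by (intro bexI[of _ v]) (auto simp: vec_2norm_def)
qed (rule spectral_norm_bdd)

lemma spectral_norm_mult_vec:
  assumes v: "v \<in> carrier_vec (dim_col X)"
  shows "(X *\<^sub>v v) \<bullet> (X *\<^sub>v v) \<le> (spectral_norm X)\<^sup>2 * (v \<bullet> v)"
proof (cases "v \<bullet> v = 0")
  case True
  then have "v = 0\<^sub>v (dim_col X)" using real_scalar_prod_self_eq_0[OF v] by simp
  then have "X *\<^sub>v v = 0\<^sub>v (dim_row X)" by (auto intro!: eq_vecI)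
  then show ?thesis using True by simp
next
  case False
  then have pos: "v \<bullet> v > 0" using scalar_prod_self_ge_0[of v] by simp
  define c where "c = 1 / sqrt (v \<bullet> v)"
  have cc: "c * c = 1 / (v \<bullet> v)" using pos by (simp add: c_def)
  have "(c \<cdot>\<^sub>v v) \<bullet> (c \<cdot>\<^sub>v v) = 1" using pos cc v by (simp add: mult.assoc[symmetric])
  then have "c \<cdot>\<^sub>v v \<in> {v \<in> carrier_vec (dim_col X). vec_2norm v \<le> 1}" using v by (simp add: vec_2norm_le_1)
  then have "vec_2norm (X *\<^sub>v (c \<cdot>\<^sub>v v)) \<le> spectral_norm X"
    unfolding spectral_norm_def by (rule cSUP_upper) (rule spectral_norm_bdd)
  then have "(vec_2norm (X *\<^sub>v (c \<cdot>\<^sub>v v)))\<^sup>2 \<le> (spectral_norm X)\<^sup>2"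
    by (rule power_mono) (simp add: vec_2norm_def scalar_prod_self_ge_0)
  moreover have "(vec_2norm (X *\<^sub>v (c \<cdot>\<^sub>v v)))\<^sup>2 = ((X *\<^sub>v v) \<bullet> (X *\<^sub>v v)) / (v \<bullet> v)"
    using mult_mat_vec[of X "dim_row X" "dim_col X" v c] v cc
    by (simp add: vec_2norm_def scalar_prod_self_ge_0 mult.assoc[symmetric])
  ultimately show ?thesis using pos by (simp add: field_simps)
qed

lemma projector_fixes_mult:
  assumes P: "P \<in> carrier_mat m r" and W: "W \<in> carrier_mat m k" and Z: "Z \<in> carrier_mat k c"
    and fix_W: "P * (P\<^sup>T * W) = W"
  shows "P * (P\<^sup>T * (W * Z)) = W * Z"
proof -
  have Pt: "P\<^sup>T \<in> carrier_mat r m" and PW: "P\<^sup>T * W \<in> carrier_mat r k" using P W by auto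
  show ?thesis
    by (simp only: assoc_mult_mat[OF Pt W Z, symmetric] assoc_mult_mat[OF P PW Z, symmetric] fix_W)
qed

lemma projector_fixes_mat:
  assumes P: "P \<in> carrier_mat m r" and W: "W \<in> carrier_mat m k"
    and fix_W: "\<And>j. j < k \<Longrightarrow> P *\<^sub>v (P\<^sup>T *\<^sub>v col W j) = col W j"
  shows "P * (P\<^sup>T * W) = W"
proof (rule mat_col_eqI)
  fix j assume "j < dim_col W"
  then have "j < k" using W by simp
  then show "col (P * (P\<^sup>T * W)) j = col W j"
    using fix_W P W col_mult2[of P m r "P\<^sup>T * W" k j] col_mult2[of "P\<^sup>T" r m W k j] by simp
qed (use P W in auto)

text \<open>The passage from the Frobenius to the spectral norm. If \<open>E\<close> is \<open>X\<close> minus a matrix of rank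
\<open>k\<close>, then \<open>E\<close> deflated along \<open>v\<close> is \<open>X\<close> minus a matrix of rank \<open>k + 1\<close>, so Eckart-Young keeps the
singular values from index \<open>k + 2\<close> on in its norm. All but that much of the squared Frobenius norm
of \<open>E\<close> is then available to \<open>|E v|\<^sup>2\<close>.\<close>

lemma low_rank_residual_mult_vec:
  assumes svd: "is_svd X U \<sigma> V" and X: "X \<in> carrier_mat m n"
    and W: "W \<in> carrier_mat m k" and Z: "Z \<in> carrier_mat k n" and k: "k < min m n"
    and v: "v \<in> carrier_vec n" "v \<bullet> v \<le> 1"
  defines "E \<equiv> X - W * Z"
  shows "(E *\<^sub>v v) \<bullet> (E *\<^sub>v v) \<le> frob_sq E - (\<Sum>i=Suc k..<min m n. (\<sigma> (Suc i))\<^sup>2)"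
proof -
  define g where "g = E *\<^sub>v v"
  have E: "E \<in> carrier_mat m n" unfolding E_def using W Z by (intro minus_carrier_mat) auto
  have g: "g \<in> carrier_vec m" using E v by (simp add: g_def)
  have WZ: "W * Z \<in> carrier_mat m n" and O: "outer_prod g v \<in> carrier_mat m n"
    using W Z g v by (auto simp: outer_prod_def)
  \<comment> \<open>The columns of \<open>W * Z + g v\<^sup>T\<close> all lie in the span of those of \<open>W\<close> and the single vector \<open>g\<close>.\<close>
  obtain P r where P: "r \<le> length (g # cols W)" "P \<in> carrier_mat m r" "orthonormal_cols P"
    and fixed: "\<And>x. x \<in> set (g # cols W) \<Longrightarrow> P *\<^sub>v (P\<^sup>T *\<^sub>v x) = x"
    using orthonormal_basis_exists[of "g # cols W" m] g W cols_dim[of W] by auto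
  have r: "r \<le> Suc k" using P(1) W by simp
  have "P * (P\<^sup>T * W) = W"
    using fixed W by (intro projector_fixes_mat[OF P(2) W]) (auto simp: cols_def)
  then have fW: "P * (P\<^sup>T * (W * Z)) = W * Z" by (rule projector_fixes_mult[OF P(2) W Z])
  have fO: "P * (P\<^sup>T * outer_prod g v) = outer_prod g v"
  proof (rule projector_fixes_mat[OF P(2) O])
    fix j assume j: "j < n"
    then have "col (outer_prod g v) j = v $ j \<cdot>\<^sub>v g" using g v by (auto simp: outer_prod_def intro!: eq_vecI)
    then show "P *\<^sub>v (P\<^sup>T *\<^sub>v col (outer_prod g v) j) = col (outer_prod g v) j"
      using fixed[of g] P(2) g by (simp add: mult_mat_vec[of _ r m] mult_mat_vec[of _ m r])
  qed
  have fC: "P * (P\<^sup>T * (W * Z + outer_prod g v)) = W * Z + outer_prod g v"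
    using P(2) WZ O fW fO by (simp add: mult_add_distrib_mat[of _ r m _ n] mult_add_distrib_mat[of _ m r _ n])
  have "X - (W * Z + outer_prod g v) = E - outer_prod g v"
    unfolding E_def by (rule eq_matI) (use X W Z WZ O in \<open>auto simp del: index_mult_mat(1)\<close>)
  then have "(\<Sum>i=Suc k..<min m n. (\<sigma> (Suc i))\<^sup>2) \<le> frob_sq (E - outer_prod g v)"
    using eckart_young_frob[OF svd X _ P(2,3) r _ fC] WZ O k by simp
  then show ?thesis using frob_sq_deflate_le[OF E v] by (simp add: g_def)
qed

section \<open>Full rank and the pseudo-inverse\<close>

text \<open>If \<open>r < k\<close>, pad \<open>X\<close> with zero columns and \<open>H\<close> with zero rows to square matrices. They are
still inverse to each other, but then the product in the other order is also the identity although
it has a zero row.\<close>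

lemma left_inverse_dim_le:
  fixes X H :: "real mat"
  assumes X: "X \<in> carrier_mat k r" and H: "H \<in> carrier_mat r k" and XH: "X * H = 1\<^sub>m k"
  shows "k \<le> r"
proof (rule ccontr)
  assume "\<not> k \<le> r"
  then have rk: "r < k" by simp
  define X' where "X' = mat k k (\<lambda>(i,j). if j < r then X $$ (i,j) else 0)"
  define H' where "H' = mat k k (\<lambda>(i,j). if i < r then H $$ (i,j) else 0)"
  have X': "X' \<in> carrier_mat k k" and H': "H' \<in> carrier_mat k k" by (auto simp: X'_def H'_def)
  have "X' * H' = X * H"
  proof (rule eq_matI)
    fix i j assume "i < dim_row (X * H)" "j < dim_col (X * H)"
    then have i: "i < k" and j: "j < k" using X H by auto
    have "(X' * H') $$ (i,j) = (\<Sum>a<k. if a < r then X $$ (i,a) * H $$ (a,j) else 0)"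
      using i j X' H' by (auto simp: scalar_prod_def lessThan_atLeast0 X'_def H'_def intro!: sum.cong)
    also have "\<dots> = (\<Sum>a<r. X $$ (i,a) * H $$ (a,j))"
      using rk by (intro sum.mono_neutral_cong_right) auto
    also have "\<dots> = (X * H) $$ (i,j)"
      using i j X H by (auto simp: scalar_prod_def lessThan_atLeast0 intro!: sum.cong)
    finally show "(X' * H') $$ (i,j) = (X * H) $$ (i,j)" .
  qed (use X H X' H' in auto)
  then have "H' * X' = 1\<^sub>m k" using mat_mult_left_right_inverse[OF X' H'] XH by simp
  then have "(H' * X') $$ (r,r) = 1" using rk by simp
  moreover have "(H' * X') $$ (r,r) = 0" using rk by (simp add: H'_def X'_def scalar_prod_def)
  ultimately show False by simp
qed

text \<open>The rank counts a maximal independent set of columns, so full rank forces the columns to be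
distinct. They are then independent as a family, and no nontrivial combination vanishes.\<close>

lemma kernel_of_full_column_rank:
  fixes A :: "real mat"
  assumes A: "A \<in> carrier_mat m n" and rank: "vec_space.rank m A = n"
    and v: "v \<in> carrier_vec n" "A *\<^sub>v v = 0\<^sub>v m"
  shows "v = 0\<^sub>v n"
proof -
  interpret vec_space "TYPE(real)" m .
  obtain S where S: "maximal S (\<lambda>T. T \<subseteq> set (cols A) \<and> lin_indpt T)"
    using maximal_exists[of "(\<lambda>T. T \<subseteq> set (cols A) \<and> lin_indpt T)" "card (set (cols A))" "{}"]
    by (meson List.finite_set card_mono empty_iff empty_subsetI finite_lin_indpt2 rev_finite_subset)
  have "n = card S" using rank_card_indpt[OF A S] rank by simp
  also have "\<dots> \<le> card (set (cols A))" using S by (simp add: card_mono maximal_def)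
  finally have "card (set (cols A)) = length (cols A)"
    using A card_length[of "cols A"] by simp
  then have dist: "distinct (cols A)" by (rule card_distinct)
  show ?thesis
  proof (rule ccontr)
    assume "v \<noteq> 0\<^sub>v n"
    then have "lin_dep (set (cols A))" using lin_depI[OF A v(1) _ v(2) dist] by simp
    then show False using full_rank_lin_indpt[OF A rank dist] by simp
  qed
qed

text \<open>A maximal independent set of columns has \<open>s\<close> elements, hence is a basis of the whole space.\<close>

lemma col_space_of_full_row_rank:
  fixes X :: "real mat"
  assumes X: "X \<in> carrier_mat s l" and rank: "vec_space.rank s X = s" and x: "x \<in> carrier_vec s"
  obtains y where "y \<in> carrier_vec l" "X *\<^sub>v y = x"
proof -
  interpret vec_space "TYPE(real)" s .
  obtain S where S: "maximal S (\<lambda>T. T \<subseteq> set (cols X) \<and> lin_indpt T)"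
    using maximal_exists[of "(\<lambda>T. T \<subseteq> set (cols X) \<and> lin_indpt T)" "card (set (cols X))" "{}"]
    by (meson List.finite_set card_mono empty_iff empty_subsetI finite_lin_indpt2 rev_finite_subset)
  have sub: "S \<subseteq> set (cols X)" "lin_indpt S" using S by (auto simp: maximal_def)
  have "card S = s" using rank_card_indpt[OF X S] rank by simp
  moreover have "S \<subseteq> carrier_vec s" using sub cols_dim[of X] X by auto
  moreover have "finite S" using sub finite_subset by auto
  ultimately have "basis S" using dim_li_is_basis[OF fin_dim, of S] sub dim_is_n by simp
  then have "x \<in> span S" using x by (simp add: basis_def)
  then have "x \<in> col_space X" unfolding col_space_def using span_is_monotone[OF sub(1)] by blast
  then show thesis using that col_space_eq[OF X] X by auto
qed

text \<open>For full row rank the Gram matrix \<open>X * X\<^sup>T\<close> is invertible, since a kernel vector is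
orthogonal to all columns of \<open>X\<close> and these span the space. So \<open>X\<^sup>T * (X * X\<^sup>T)\<^sup>-\<^sup>1\<close> is a right
inverse, and it satisfies the four Penrose conditions.\<close>

lemma pseudo_inverse_right_inverse:
  fixes X :: "real mat"
  assumes X: "X \<in> carrier_mat s l" and rank: "vec_space.rank s X = s"
  shows "pseudo_inverse X \<in> carrier_mat l s" "X * pseudo_inverse X = 1\<^sub>m s"
proof -
  define G where "G = X * X\<^sup>T"
  have G: "G \<in> carrier_mat s s" using X by (simp add: G_def)
  have "det G \<noteq> 0"
  proof
    assume "det G = 0"
    then obtain x where x: "x \<in> carrier_vec s" "x \<noteq> 0\<^sub>v s" "G *\<^sub>v x = 0\<^sub>v s"
      using det_0_iff_vec_prod_zero_field[OF G] by auto
    define z where "z = X\<^sup>T *\<^sub>v x"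
    have z: "z \<in> carrier_vec l" using X x by (simp add: z_def)
    have "X *\<^sub>v z = 0\<^sub>v s"
      using x assoc_mult_mat_vec[of X s l "X\<^sup>T" s x] X by (simp add: G_def z_def)
    then have "z \<bullet> z = 0"
      using mult_mat_vec_adjoint[OF X z x(1)] x by (simp add: z_def)
    then have z0: "z = 0\<^sub>v l" using real_scalar_prod_self_eq_0 z by blast
    obtain y where y: "y \<in> carrier_vec l" "X *\<^sub>v y = x"
      using col_space_of_full_row_rank[OF X rank x(1)] .
    have "x \<bullet> x = y \<bullet> z" using mult_mat_vec_adjoint[OF X y(1) x(1)] y by (simp add: z_def)
    then have "x \<bullet> x = 0" using z0 y by simp
    then show False using real_scalar_prod_self_eq_0 x by blast
  qed
  then obtain H where H: "H \<in> carrier_mat s s" "G * H = 1\<^sub>m s" "H * G = 1\<^sub>m s"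
    using det_non_zero_imp_unit[OF G, of "()"] unfolding Units_def ring_mat_simps by blast
  define P where "P = X\<^sup>T * H"
  have P: "P \<in> carrier_mat l s" using X H by (simp add: P_def)
  have XP: "X * P = 1\<^sub>m s"
    using assoc_mult_mat[of X s l "X\<^sup>T" s H s] X H by (simp add: P_def G_def)
  have Gt: "G\<^sup>T = G" using transpose_mult[of X s l "X\<^sup>T" s] X by (simp add: G_def)
  have "H\<^sup>T * G = 1\<^sub>m s" using transpose_mult[OF G H(1)] H Gt by simp
  then have "H\<^sup>T * G * H = H" using H(1) by simp
  moreover have "H\<^sup>T * G * H = H\<^sup>T"
    using assoc_mult_mat[of "H\<^sup>T" s s G s H s] G H(1,2) by simp
  ultimately have Ht: "H\<^sup>T = H" by simp
  have PX: "(P * X)\<^sup>T = P * X"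
  proof -
    have "(P * X)\<^sup>T = X\<^sup>T * P\<^sup>T" by (rule transpose_mult[OF P X])
    also have "P\<^sup>T = H\<^sup>T * X" using transpose_mult[of "X\<^sup>T" l s H s] X H by (simp add: P_def)
    also have "X\<^sup>T * (H\<^sup>T * X) = P * X" using X H by (simp add: Ht P_def assoc_mult_mat[of _ l s _ s _ l])
    finally show ?thesis .
  qed
  have "is_pseudo_inverse X P"
    unfolding is_pseudo_inverse_def using X P XP PX assoc_mult_mat[OF P X P] by auto
  then have "pseudo_inverse X = P" by (rule pseudo_inverse_eqI)
  then show "pseudo_inverse X \<in> carrier_mat l s" "X * pseudo_inverse X = 1\<^sub>m s" using P XP by auto
qed

section \<open>Truncation and powers of a singular value decomposition\<close>

lemma mat_diag_mult_vec:
  fixes f :: "nat \<Rightarrow> real"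
  assumes "x \<in> carrier_vec n"
  shows "mat_diag n f *\<^sub>v x = vec n (\<lambda>i. f i * x $ i)"
proof (rule eq_vecI)
  fix i assume "i < dim_vec (vec n (\<lambda>i. f i * x $ i))"
  then have i: "i < n" by simp
  then have "(mat_diag n f *\<^sub>v x) $ i = (\<Sum>j<n. (if i = j then f j * x $ j else 0))"
    using assms by (auto simp: mat_diag_def scalar_prod_def lessThan_atLeast0 if_distrib[of "\<lambda>c. c * _"] cong: if_cong intro!: sum.cong)
  then show "(mat_diag n f *\<^sub>v x) $ i = vec n (\<lambda>i. f i * x $ i) $ i" using i by simp
qed (simp add: mat_diag_def)

lemma first_cols_carrier:
  assumes "X \<in> carrier_mat m d" "k \<le> d"
  shows "first_cols k X \<in> carrier_mat m k"
  using assms by (auto simp: first_cols_def mat_of_cols_def)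

lemma first_cols_index:
  assumes "X \<in> carrier_mat m d" "k \<le> d" "i < m" "j < k"
  shows "first_cols k X $$ (i, j) = X $$ (i, j)"
  using assms by (auto simp: first_cols_def mat_of_cols_index)

lemma first_cols_col:
  assumes "X \<in> carrier_mat m d" "k \<le> d" "j < k"
  shows "col (first_cols k X) j = col X j"
  using assms first_cols_carrier[OF assms(1,2)] by (auto intro!: eq_vecI simp: first_cols_index)

lemma first_cols_orthonormal:
  assumes X: "X \<in> carrier_mat m d" "k \<le> d" "orthonormal_cols X"
  shows "orthonormal_cols (first_cols k X)"
  unfolding orthonormal_cols_def
  using first_cols_carrier[OF X(1,2)] X
  by (intro eq_matI) (auto simp: first_cols_col[OF X(1,2)] orthonormal_cols_scalar_prod[OF X(1,3)])

text \<open>The truncated SVD is the projection of \<open>B\<close> onto its leading left singular vectors. In this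
form the error of \<open>Q * B\<^sub>k\<close> is the residual of a projection, for which Pythagoras gives the norm.\<close>

lemma truncated_svd_is_projection:
  assumes svd: "is_svd B U \<sigma> V" and B: "B \<in> carrier_mat r n" and k: "k \<le> min r n"
  defines "U\<^sub>k \<equiv> first_cols k U"
  shows "first_cols k U * mat_diag k (\<lambda>i. \<sigma> (Suc i)) * (first_cols k V)\<^sup>T = U\<^sub>k * (U\<^sub>k\<^sup>T * B)"
    and "frob_sq (U\<^sub>k\<^sup>T * B) = (\<Sum>i<k. (\<sigma> (Suc i))\<^sup>2)"
proof -
  define d where "d = min r n"
  define D where "D = mat_diag d (\<lambda>i. \<sigma> (Suc i))"
  define D\<^sub>k where "D\<^sub>k = mat_diag k (\<lambda>i. \<sigma> (Suc i))"
  have kd: "k \<le> d" using k by (simp add: d_def)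
  have U: "U \<in> carrier_mat r d" "orthonormal_cols U" and V: "V \<in> carrier_mat n d" "orthonormal_cols V"
    and B_eq: "B = U * D * V\<^sup>T"
    by (fact is_svdD[OF svd B, folded d_def, folded D_def])+
  have D: "D \<in> carrier_mat d d" and Dk: "D\<^sub>k \<in> carrier_mat k k" by (auto simp: D_def D\<^sub>k_def)
  have Uk: "U\<^sub>k \<in> carrier_mat r k" unfolding U\<^sub>k_def by (rule first_cols_carrier[OF U(1) kd])
  have Vk: "first_cols k V \<in> carrier_mat n k" by (rule first_cols_carrier[OF V(1) kd])
  have "U\<^sub>k\<^sup>T * B = U\<^sub>k\<^sup>T * U * D * V\<^sup>T"
    unfolding B_eq using Uk U V D
    by (simp add: assoc_mult_mat[of _ k r _ d _ d] assoc_mult_mat[of _ k r _ d _ n] assoc_mult_mat[of _ k d _ d _ n])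
  also have "\<dots> = D\<^sub>k * (first_cols k V)\<^sup>T"
  proof (rule eq_matI)
    fix i j assume "i < dim_row (D\<^sub>k * (first_cols k V)\<^sup>T)" "j < dim_col (D\<^sub>k * (first_cols k V)\<^sup>T)"
    then have i: "i < k" "i < d" and j: "j < n" using Vk Dk kd by auto
    have UU: "(U\<^sub>k\<^sup>T * U * D) $$ (i,a) = (if a = i then \<sigma> (Suc i) else 0)" if "a < d" for a
      using that i Uk U kd unfolding D_def
      by (subst mat_diag_mult_right[of _ k d])
        (auto simp: U\<^sub>k_def first_cols_col[OF U(1) kd] orthonormal_cols_scalar_prod[OF U])
    define M where "M = U\<^sub>k\<^sup>T * U * D"
    have M: "M \<in> carrier_mat k d" using Uk U D by (simp add: M_def)
    have "(U\<^sub>k\<^sup>T * U * D * V\<^sup>T) $$ (i,j) = (\<Sum>a<d. M $$ (i,a) * V $$ (j,a))"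
      using i j M V unfolding M_def[symmetric] by (simp add: scalar_prod_def lessThan_atLeast0)
    also have "\<dots> = (\<Sum>a<d. if a = i then \<sigma> (Suc i) * V $$ (j,i) else 0)"
      by (intro sum.cong) (auto simp: UU[folded M_def])
    also have "\<dots> = \<sigma> (Suc i) * V $$ (j,i)" using i by simp
    also have "\<dots> = (D\<^sub>k * (first_cols k V)\<^sup>T) $$ (i,j)"
      unfolding D\<^sub>k_def using i j Vk
      by (subst mat_diag_mult_left[of _ k n]) (auto simp: first_cols_index[OF V(1) kd])
    finally show "(U\<^sub>k\<^sup>T * U * D * V\<^sup>T) $$ (i,j) = (D\<^sub>k * (first_cols k V)\<^sup>T) $$ (i,j)" .
  qed (use Uk U D V Vk Dk in auto)
  finally have eq: "U\<^sub>k\<^sup>T * B = D\<^sub>k * (first_cols k V)\<^sup>T" .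
  show "first_cols k U * mat_diag k (\<lambda>i. \<sigma> (Suc i)) * (first_cols k V)\<^sup>T = U\<^sub>k * (U\<^sub>k\<^sup>T * B)"
    unfolding eq U\<^sub>k_def[symmetric] D\<^sub>k_def[symmetric] by (rule assoc_mult_mat[OF Uk Dk]) (use Vk in simp)
  have "frob_sq (U\<^sub>k\<^sup>T * B) = frob_sq D\<^sub>k"
    unfolding eq using V kd by (intro frob_sq_orthonormal_right[OF Vk _ Dk] first_cols_orthonormal[OF V(1)])
  also have "\<dots> = (\<Sum>j<k. \<Sum>i<k. if i = j then (\<sigma> (Suc j))\<^sup>2 else 0)"
    unfolding frob_sq_entries D\<^sub>k_def mat_diag_def by (intro sum.cong) auto
  also have "\<dots> = (\<Sum>i<k. (\<sigma> (Suc i))\<^sup>2)" by simp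
  finally show "frob_sq (U\<^sub>k\<^sup>T * B) = (\<Sum>i<k. (\<sigma> (Suc i))\<^sup>2)" .
qed

lemma svd_mult_vec:
  assumes svd: "is_svd A U \<sigma> V" and A: "A \<in> carrier_mat m n" and "n \<le> m" and x: "x \<in> carrier_vec n"
  shows "A *\<^sub>v x = U *\<^sub>v vec n (\<lambda>i. \<sigma> (Suc i) * (V\<^sup>T *\<^sub>v x) $ i)"
proof -
  define D where "D = mat_diag n (\<lambda>i. \<sigma> (Suc i))"
  have U: "U \<in> carrier_mat m n" and V: "V \<in> carrier_mat n n" and A_eq: "A = U * D * V\<^sup>T"
    by (fact is_svdD[OF svd A, unfolded min_absorb2[OF \<open>n \<le> m\<close>], folded D_def])+
  have D: "D \<in> carrier_mat n n" by (simp add: D_def)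
  have "A *\<^sub>v x = U *\<^sub>v (D *\<^sub>v (V\<^sup>T *\<^sub>v x))"
    unfolding A_eq using U D V x by (simp add: assoc_mult_mat_vec[of _ m n _ n])
  then show ?thesis using mat_diag_mult_vec[of "V\<^sup>T *\<^sub>v x" n] V x by (simp add: D_def)
qed

lemma svd_transpose:
  assumes svd: "is_svd A U \<sigma> V" and A: "A \<in> carrier_mat m n"
  shows "is_svd A\<^sup>T V \<sigma> U"
proof -
  define d where "d = min m n"
  define D where "D = mat_diag d (\<lambda>i. \<sigma> (Suc i))"
  have dims: "dim_row A = m" "dim_col A = n" "min n m = d" using A by (auto simp: d_def)
  note parts = is_svdD[OF svd A, folded d_def, folded D_def]
  note A_eq = parts(5)
  have D: "D \<in> carrier_mat d d" "D\<^sup>T = D" by (auto simp: D_def mat_diag_def)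
  have "A\<^sup>T = V * (U * D)\<^sup>T"
    using arg_cong[OF A_eq, of transpose_mat] transpose_mult[of "U * D" m d "V\<^sup>T" n] parts(1,3) D by simp
  also have "(U * D)\<^sup>T = D * U\<^sup>T" using transpose_mult[OF parts(1) D(1)] D by simp
  also have "V * (D * U\<^sup>T) = V * D * U\<^sup>T"
    by (rule assoc_mult_mat[symmetric, OF parts(3) D(1)]) (use parts(1) in simp)
  finally have At: "A\<^sup>T = V * D * U\<^sup>T" .
  show ?thesis
    unfolding is_svd_def Let_def index_transpose_mat dims D_def[symmetric]
    by (intro conjI allI impI; (fact At | simp add: parts(1-4,6,7)))
qed

text \<open>A vanishing singular value would put the corresponding right singular vector into the kernel
of \<open>A\<close>.\<close>

lemma svd_sigma_pos:
  assumes svd: "is_svd A U \<sigma> V" and A: "A \<in> carrier_mat m n" and "n \<le> m"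
    and rank: "vec_space.rank m A = n" and i: "1 \<le> i" "i \<le> n"
  shows "0 < \<sigma> i"
proof -
  have U: "U \<in> carrier_mat m n" and V: "V \<in> carrier_mat n n" "orthonormal_cols V" and "0 \<le> \<sigma> i"
    using is_svdD(1,3,4)[OF svd A] is_svdD(7)[OF svd A i(1)] i \<open>n \<le> m\<close> by (simp_all add: min_absorb2)
  moreover have "\<sigma> i \<noteq> 0"
  proof
    assume 0: "\<sigma> i = 0"
    have v: "col V (i - 1) \<in> carrier_vec n" using V i by auto
    have "vec n (\<lambda>j. \<sigma> (Suc j) * (V\<^sup>T *\<^sub>v col V (i - 1)) $ j) = 0\<^sub>v n"
      using V i 0 by (intro eq_vecI) (auto simp: orthonormal_cols_scalar_prod[OF V])
    then have "A *\<^sub>v col V (i - 1) = 0\<^sub>v m"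
      using svd_mult_vec[OF svd A \<open>n \<le> m\<close> v] U by (auto intro!: eq_vecI)
    then have "col V (i - 1) = 0\<^sub>v n" using kernel_of_full_column_rank[OF A rank v] by simp
    then show False using orthonormal_cols_col_sq[OF V, of "i - 1"] i by (cases i) auto
  qed
  ultimately show ?thesis by simp
qed

text \<open>In the coordinates given by the left singular vectors, \<open>A * A\<^sup>T\<close> is the diagonal matrix of
the squared singular values.\<close>

lemma power_iteration_left_vectors:
  assumes svd: "is_svd A U \<sigma> V" and A: "A \<in> carrier_mat m n" and "n \<le> m" and x: "x \<in> carrier_vec n"
  shows "((A * A\<^sup>T) ^\<^sub>m q) *\<^sub>v (U *\<^sub>v x) = U *\<^sub>v vec n (\<lambda>i. \<sigma> (Suc i) ^ (2 * q) * x $ i)"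
  using x
proof (induction q arbitrary: x)
  case 0
  have "vec n (\<lambda>i. x $ i) = x" using 0 by auto
  moreover have "U *\<^sub>v x \<in> carrier_vec m" using is_svdD(1)[OF svd A] 0 \<open>n \<le> m\<close> by (simp add: min_absorb2)
  ultimately show ?case using A by simp
next
  case (Suc q)
  have U: "U \<in> carrier_mat m n" "orthonormal_cols U" and V: "V \<in> carrier_mat n n" "orthonormal_cols V"
    by (fact is_svdD[OF svd A, unfolded min_absorb2[OF \<open>n \<le> m\<close>]])+
  define y where "y = vec n (\<lambda>i. \<sigma> (Suc i) * x $ i)"
  have y: "y \<in> carrier_vec n" by (simp add: y_def)
  have Ux: "U *\<^sub>v x \<in> carrier_vec m" using U Suc.prems by simp
  define D where "D = mat_diag n (\<lambda>i. \<sigma> (Suc i))"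
  have D: "D \<in> carrier_mat n n" by (simp add: D_def)
  have "A\<^sup>T \<in> carrier_mat n m" using A by simp
  then have "A\<^sup>T = V * D * U\<^sup>T"
    unfolding D_def by (rule is_svdD(5)[OF svd_transpose[OF svd A] _, of n m, unfolded min_absorb1[OF \<open>n \<le> m\<close>]])
  then have "A\<^sup>T *\<^sub>v (U *\<^sub>v x) = V *\<^sub>v (D *\<^sub>v (U\<^sup>T *\<^sub>v (U *\<^sub>v x)))"
    using U D V Ux by (simp add: assoc_mult_mat_vec[of _ n n _ m] assoc_mult_mat_vec[of _ n n _ n])
  also have "\<dots> = V *\<^sub>v y"
    using orthonormal_cols_cancel[OF U Suc.prems] mat_diag_mult_vec[OF Suc.prems] by (simp add: D_def y_def)
  finally have "A *\<^sub>v (A\<^sup>T *\<^sub>v (U *\<^sub>v x)) = U *\<^sub>v vec n (\<lambda>i. \<sigma> (Suc i) * y $ i)"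
    using svd_mult_vec[OF svd A \<open>n \<le> m\<close>, of "V *\<^sub>v y"] V y orthonormal_cols_cancel[OF V y] by simp
  then have step: "(A * A\<^sup>T) *\<^sub>v (U *\<^sub>v x) = U *\<^sub>v vec n (\<lambda>i. \<sigma> (Suc i) * y $ i)"
    using A Ux by (simp add: assoc_mult_mat_vec[of A m n _ m])
  have G: "A * A\<^sup>T \<in> carrier_mat m m" using A by simp
  have Gq: "(A * A\<^sup>T) ^\<^sub>m q \<in> carrier_mat m m" using G by (rule pow_carrier_mat)
  have "((A * A\<^sup>T) ^\<^sub>m Suc q) *\<^sub>v (U *\<^sub>v x) = ((A * A\<^sup>T) ^\<^sub>m q) *\<^sub>v ((A * A\<^sup>T) *\<^sub>v (U *\<^sub>v x))"
    using assoc_mult_mat_vec[OF Gq G Ux] by simp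
  also have "\<dots> = U *\<^sub>v vec n (\<lambda>i. \<sigma> (Suc i) ^ (2 * q) * vec n (\<lambda>i. \<sigma> (Suc i) * y $ i) $ i)"
    unfolding step by (rule Suc.IH) simp
  also have "vec n (\<lambda>i. \<sigma> (Suc i) ^ (2 * q) * vec n (\<lambda>i. \<sigma> (Suc i) * y $ i) $ i) =
      vec n (\<lambda>i. \<sigma> (Suc i) ^ (2 * Suc q) * x $ i)"
    by (auto simp: y_def)
  finally show ?case .
qed

section \<open>Energy captured by the sampled subspace\<close>

text \<open>The heart of the argument. Feeding \<open>z = \<Omega>\<^sub>1\<^sup>\<dagger> e\<^sub>j / \<sigma>\<^sub>j\<^bsup>2q+1\<^esup>\<close> to \<open>Y\<close> produces a vector in
the sampled range whose first \<open>s\<close> coordinates with respect to the left singular vectors are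
exactly those of \<open>u\<^sub>j\<close> (indices counted from 1). The remaining coordinates are those of
\<open>\<Omega>\<^sub>2 \<Omega>\<^sub>1\<^sup>\<dagger> e\<^sub>j\<close>, damped by \<open>(\<sigma>\<^sub>i / \<sigma>\<^sub>j)\<^bsup>2q+1\<^esup>\<close> with \<open>i > s\<close>. So the sampled range contains an
approximation of each \<open>u\<^sub>j\<close> with \<open>j \<le> s\<close> whose error is governed by the decay of the singular
values.\<close>

lemma sketch_vector_exists:
  fixes q :: nat
  assumes svd: "is_svd A U \<sigma> V" and A: "A \<in> carrier_mat m n" and "n \<le> m"
    and \<Omega>: "\<Omega> \<in> carrier_mat n l" and \<Omega>1: "\<Omega>\<^sub>1 \<in> carrier_mat s l" and \<Omega>2: "\<Omega>\<^sub>2 \<in> carrier_mat (n - s) l"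
    and part: "V\<^sup>T * \<Omega> = \<Omega>\<^sub>1 @\<^sub>r \<Omega>\<^sub>2" and sn: "s < n"
    and rank: "vec_space.rank s \<Omega>\<^sub>1 = s"
    and pos: "\<And>i. 1 \<le> i \<Longrightarrow> i \<le> n \<Longrightarrow> 0 < \<sigma> i"
    and j: "j < s"
  defines "Y \<equiv> (A * A\<^sup>T) ^\<^sub>m q * A * \<Omega>"
  defines "w \<equiv> (spectral_norm \<Omega>\<^sub>2)\<^sup>2 * (spectral_norm (pseudo_inverse \<Omega>\<^sub>1))\<^sup>2"
  shows "\<exists>z\<in>carrier_vec l. \<exists>x\<in>carrier_vec n. Y *\<^sub>v z = U *\<^sub>v x \<and>
    (\<forall>i<s. x $ i = (if i = j then 1 else 0)) \<and>
    x \<bullet> x \<le> 1 + w * (\<sigma> (s + 1) / \<sigma> (j + 1)) ^ (2 * (2 * q + 1))"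
proof -
  define N where "N = 2 * q + 1"
  define \<Omega>p where "\<Omega>p = pseudo_inverse \<Omega>\<^sub>1"
  have \<Omega>p: "\<Omega>p \<in> carrier_mat l s" "\<Omega>\<^sub>1 * \<Omega>p = 1\<^sub>m s"
    using pseudo_inverse_right_inverse[OF \<Omega>1 rank] by (auto simp: \<Omega>p_def)
  have U: "U \<in> carrier_mat m n" and V: "V \<in> carrier_mat n n"
    and dec: "\<And>i j. 1 \<le> i \<Longrightarrow> i \<le> j \<Longrightarrow> j \<le> n \<Longrightarrow> \<sigma> j \<le> \<sigma> i"
    by (fact is_svdD[OF svd A, unfolded min_absorb2[OF \<open>n \<le> m\<close>]])+
  define e where "e = (unit_vec s j :: real vec)"
  define c where "c = 1 / \<sigma> (j + 1) ^ N"
  have e: "e \<in> carrier_vec s" by (simp add: e_def)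
  have ee: "e \<bullet> e = 1" using j by (simp add: e_def)
  have pj: "0 < \<sigma> (j + 1)" using pos j sn by simp
  \<comment> \<open>The scaling by \<open>c\<close> makes the \<open>j\<close>-th coordinate of the sketch equal to 1.\<close>
  define z where "z = c \<cdot>\<^sub>v (\<Omega>p *\<^sub>v e)"
  have pe: "\<Omega>p *\<^sub>v e \<in> carrier_vec l" using \<Omega>p e by simp
  then have z: "z \<in> carrier_vec l" by (simp add: z_def)
  define u where "u = \<Omega>\<^sub>2 *\<^sub>v (\<Omega>p *\<^sub>v e)"
  have u: "u \<in> carrier_vec (n - s)" using \<Omega>2 pe by (simp add: u_def)
  have "\<Omega>\<^sub>1 *\<^sub>v (\<Omega>p *\<^sub>v e) = e" using assoc_mult_mat_vec[OF \<Omega>1 \<Omega>p(1) e] \<Omega>p e by simp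
  then have O1z: "\<Omega>\<^sub>1 *\<^sub>v z = c \<cdot>\<^sub>v e" and O2z: "\<Omega>\<^sub>2 *\<^sub>v z = c \<cdot>\<^sub>v u"
    unfolding z_def u_def using mult_mat_vec[OF \<Omega>1 pe] mult_mat_vec[OF \<Omega>2 pe] by auto
  define y where "y = V\<^sup>T *\<^sub>v (\<Omega> *\<^sub>v z)"
  have y: "y \<in> carrier_vec n" using V \<Omega> z by (simp add: y_def)
  have "y = (V\<^sup>T * \<Omega>) *\<^sub>v z" unfolding y_def using V \<Omega> z by (intro assoc_mult_mat_vec[symmetric, of _ n n]) auto
  also have "\<dots> = (c \<cdot>\<^sub>v e) @\<^sub>v (c \<cdot>\<^sub>v u)"
    unfolding part mat_mult_append[OF \<Omega>1 \<Omega>2 z] O1z O2z ..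
  finally have y_eq: "y = (c \<cdot>\<^sub>v e) @\<^sub>v (c \<cdot>\<^sub>v u)" .
  have yi: "y $ i = (if i < s then c * e $ i else c * u $ (i - s))" if "i < n" for i
    using that e u sn unfolding y_eq by auto
  define x where "x = vec n (\<lambda>i. \<sigma> (Suc i) ^ N * y $ i)"
  have x: "x \<in> carrier_vec n" by (simp add: x_def)
  have G: "(A * A\<^sup>T) ^\<^sub>m q \<in> carrier_mat m m" using A by (intro pow_carrier_mat) simp
  have Oz: "\<Omega> *\<^sub>v z \<in> carrier_vec n" using \<Omega> z by simp
  have "Y *\<^sub>v z = (A * A\<^sup>T) ^\<^sub>m q *\<^sub>v (A *\<^sub>v (\<Omega> *\<^sub>v z))"
    unfolding Y_def using assoc_mult_mat_vec[OF mult_carrier_mat[OF G A] \<Omega> z] assoc_mult_mat_vec[OF G A Oz] by simp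
  also have "A *\<^sub>v (\<Omega> *\<^sub>v z) = U *\<^sub>v vec n (\<lambda>i. \<sigma> (Suc i) * y $ i)"
    using svd_mult_vec[OF svd A \<open>n \<le> m\<close> Oz] by (simp add: y_def)
  also have "(A * A\<^sup>T) ^\<^sub>m q *\<^sub>v (U *\<^sub>v vec n (\<lambda>i. \<sigma> (Suc i) * y $ i)) =
      U *\<^sub>v vec n (\<lambda>i. \<sigma> (Suc i) ^ (2 * q) * vec n (\<lambda>i. \<sigma> (Suc i) * y $ i) $ i)"
    by (rule power_iteration_left_vectors[OF svd A \<open>n \<le> m\<close>]) simp
  also have "vec n (\<lambda>i. \<sigma> (Suc i) ^ (2 * q) * vec n (\<lambda>i. \<sigma> (Suc i) * y $ i) $ i) = x"
    by (auto simp: x_def N_def)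
  finally have Yz: "Y *\<^sub>v z = U *\<^sub>v x" .
  have xi: "x $ i = (if i = j then 1 else 0)" if "i < s" for i
    using that sn pj j by (simp add: x_def yi e_def c_def)
  define T where "T = (\<sigma> (s + 1) / \<sigma> (j + 1)) ^ N"
  have T0: "0 \<le> T" using pos[of "s + 1"] pj sn by (simp add: T_def)
  have tail: "(x $ (s + i))\<^sup>2 \<le> T\<^sup>2 * (u $ i)\<^sup>2" if i: "i < n - s" for i
  proof -
    have si: "s + i < n" using i by linarith
    have "x $ (s + i) = (\<sigma> (Suc (s + i)) / \<sigma> (j + 1)) ^ N * u $ i"
      using si yi[OF si] by (simp add: x_def c_def power_divide)
    moreover have "(\<sigma> (Suc (s + i)) / \<sigma> (j + 1)) ^ N \<le> T"
      unfolding T_def using dec[of "s + 1" "Suc (s + i)"] pos[of "Suc (s + i)"] pj si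
      by (intro power_mono divide_right_mono) auto
    moreover have "0 \<le> (\<sigma> (Suc (s + i)) / \<sigma> (j + 1)) ^ N" using pos[of "Suc (s + i)"] pj si by simp
    ultimately show ?thesis by (auto simp: power_mult_distrib intro!: mult_right_mono power_mono)
  qed
  have uu: "u \<bullet> u \<le> w"
  proof -
    have "u \<bullet> u \<le> (spectral_norm \<Omega>\<^sub>2)\<^sup>2 * ((\<Omega>p *\<^sub>v e) \<bullet> (\<Omega>p *\<^sub>v e))"
      unfolding u_def using pe \<Omega>2 by (intro spectral_norm_mult_vec) simp
    also have "(\<Omega>p *\<^sub>v e) \<bullet> (\<Omega>p *\<^sub>v e) \<le> (spectral_norm \<Omega>p)\<^sup>2"
      using spectral_norm_mult_vec[of e \<Omega>p] \<Omega>p e ee by simp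
    finally show ?thesis by (simp add: w_def \<Omega>p_def mult_left_mono)
  qed
  have "x \<bullet> x = (\<Sum>i<n. (x $ i)\<^sup>2)" using x by (simp add: scalar_prod_def power2_eq_square lessThan_atLeast0)
  also have "\<dots> = (\<Sum>i<s. (x $ i)\<^sup>2) + (\<Sum>i<n - s. (x $ (s + i))\<^sup>2)"
    using sum.atLeastLessThan_concat[of 0 s n "\<lambda>i. (x $ i)\<^sup>2"] sn
      sum.atLeastLessThan_shift_0[of "\<lambda>i. (x $ i)\<^sup>2" s n]
    by (simp add: lessThan_atLeast0)
  also have "(\<Sum>i<s. (x $ i)\<^sup>2) = (\<Sum>i<s. if i = j then 1 else 0)" by (intro sum.cong) (auto simp: xi)
  also have "\<dots> = 1" using j by simp
  also have "(\<Sum>i<n - s. (x $ (s + i))\<^sup>2) \<le> (\<Sum>i<n - s. T\<^sup>2 * (u $ i)\<^sup>2)" by (intro sum_mono) (auto intro: tail)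
  also have "\<dots> = T\<^sup>2 * (u \<bullet> u)"
    using u by (simp add: scalar_prod_def power2_eq_square lessThan_atLeast0 sum_distrib_left)
  also have "T\<^sup>2 * (u \<bullet> u) \<le> T\<^sup>2 * w" by (rule mult_left_mono[OF uu]) simp
  finally have "x \<bullet> x \<le> 1 + w * T\<^sup>2" by (simp add: mult.commute)
  moreover have "T\<^sup>2 = (\<sigma> (s + 1) / \<sigma> (j + 1)) ^ (2 * (2 * q + 1))"
    unfolding T_def N_def by (simp only: power_mult[symmetric] mult.commute)
  ultimately have "x \<bullet> x \<le> 1 + w * (\<sigma> (s + 1) / \<sigma> (j + 1)) ^ (2 * (2 * q + 1))" by (simp only:)
  then show ?thesis using z x Yz xi by blast
qed

text \<open>The sketch vectors \<open>U *\<^sub>v x j\<close> are biorthogonal to the leading left singular vectors, hence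
independent. This guarantees that \<open>Q\<close> has at least \<open>k\<close> columns, without which truncating to rank
\<open>k\<close> would be meaningless.\<close>

lemma range_dim_ge:
  assumes U: "U \<in> carrier_mat m n" "orthonormal_cols U" and Q: "Q \<in> carrier_mat m r" and "k \<le> n"
    and x: "\<And>j. j < k \<Longrightarrow> x j \<in> carrier_vec n" "\<And>i j. i < k \<Longrightarrow> j < k \<Longrightarrow> x j $ i = (if i = j then 1 else 0)"
    and h: "\<And>j. j < k \<Longrightarrow> h j \<in> carrier_vec r" "\<And>j. j < k \<Longrightarrow> Q *\<^sub>v h j = U *\<^sub>v x j"
  shows "k \<le> r"
proof -
  define H where "H = mat_of_cols r (map h [0..<k])"
  have H: "H \<in> carrier_mat r k" unfolding H_def using mat_of_cols_carrier(1)[of r "map h [0..<k]"] by simp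
  have colH: "col H j = h j" if "j < k" for j using that h(1) by (simp add: H_def)
  define F where "F = (first_cols k U)\<^sup>T"
  have Fk: "first_cols k U \<in> carrier_mat m k" by (rule first_cols_carrier[OF U(1) \<open>k \<le> n\<close>])
  have F: "F \<in> carrier_mat k m" using Fk by (simp add: F_def)
  have "F * Q * H = 1\<^sub>m k"
  proof (rule eq_matI)
    fix i j assume "i < dim_row (1\<^sub>m k)" "j < dim_col (1\<^sub>m k)"
    then have i: "i < k" and j: "j < k" by auto
    have "F * Q * H = F * (Q * H)" by (rule assoc_mult_mat[OF F Q H])
    then have "(F * Q * H) $$ (i,j) = row F i \<bullet> col (Q * H) j" using i j F Q H by simp
    also have "\<dots> = col U i \<bullet> (U *\<^sub>v x j)"
      using i j F Fk Q H h(2)[OF j] col_mult2[OF Q H j] colH[OF j] first_cols_col[OF U(1) \<open>k \<le> n\<close> i]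
      by (simp add: F_def)
    also have "\<dots> = (U\<^sup>T *\<^sub>v (U *\<^sub>v x j)) $ i" using i U \<open>k \<le> n\<close> by simp
    also have "\<dots> = x j $ i" using orthonormal_cols_cancel[OF U x(1)[OF j]] by simp
    finally show "(F * Q * H) $$ (i,j) = 1\<^sub>m k $$ (i,j)" using i j x(2) by simp
  qed (use F H in auto)
  then show ?thesis using left_inverse_dim_le[of "F * Q" k r H] F Q H by simp
qed

text \<open>By Ky Fan it suffices to exhibit one subspace of the range of \<open>Q\<close>, of dimension at most \<open>k\<close>,
that captures the energy on the left. The span of the \<open>k\<close> sketch vectors does: it contains the
vector \<open>U *\<^sub>v x j\<close>, whose inner product with \<open>u\<^sub>j\<close> is 1 and whose squared length is at most \<open>\<beta> j\<close>,
so by Cauchy-Schwarz the projection of \<open>u\<^sub>j\<close> onto it has squared length at least \<open>1 / \<beta> j\<close>.\<close>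

lemma captured_energy_ge:
  assumes svd: "is_svd A U \<sigma> V" and A: "A \<in> carrier_mat m n" and "n \<le> m"
    and Q: "Q \<in> carrier_mat m r" "orthonormal_cols Q"
    and svdB: "is_svd (Q\<^sup>T * A) U\<^sub>B \<sigma>\<^sub>B V\<^sub>B" and k: "k \<le> min r n"
    and h: "\<And>j. j < k \<Longrightarrow> h j \<in> carrier_vec r" "\<And>j. j < k \<Longrightarrow> Q *\<^sub>v h j = U *\<^sub>v x j"
    and x: "\<And>j. j < k \<Longrightarrow> x j \<in> carrier_vec n" "\<And>j. j < k \<Longrightarrow> x j $ j = 1"
    and \<beta>: "\<And>j. j < k \<Longrightarrow> x j \<bullet> x j \<le> \<beta> j"
  shows "(\<Sum>j<k. (\<sigma> (Suc j))\<^sup>2 / \<beta> j) \<le> (\<Sum>j<k. (\<sigma>\<^sub>B (Suc j))\<^sup>2)"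
proof -
  have U: "U \<in> carrier_mat m n" "orthonormal_cols U"
    by (fact is_svdD[OF svd A, unfolded min_absorb2[OF \<open>n \<le> m\<close>]])+
  obtain P k' where P: "k' \<le> k" "P \<in> carrier_mat r k'" "orthonormal_cols P"
    and fixed: "\<And>j. j < k \<Longrightarrow> P *\<^sub>v (P\<^sup>T *\<^sub>v h j) = h j"
  proof -
    have "set (map h [0..<k]) \<subseteq> carrier_vec r" using h(1) by auto
    from orthonormal_basis_exists[OF this] show thesis using that by auto
  qed
  have B: "Q\<^sup>T * A \<in> carrier_mat r n" using Q A by simp
  define W where "W = Q * P"
  have W: "W \<in> carrier_mat m k'" using Q P by (simp add: W_def)
  have Wt: "W\<^sup>T * A = P\<^sup>T * (Q\<^sup>T * A)"
    unfolding W_def using transpose_mult[OF Q(1) P(2)] assoc_mult_mat[of "P\<^sup>T" k' r "Q\<^sup>T" m A n] P Q A by simp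
  define c where "c j = (W\<^sup>T *\<^sub>v col U j) \<bullet> (W\<^sup>T *\<^sub>v col U j)" for j
  have "(\<sigma> (Suc j))\<^sup>2 / \<beta> j \<le> (\<sigma> (Suc j))\<^sup>2 * c j" if j: "j < k" for j
  proof -
    have jn: "j < n" using j k by simp
    define y where "y = P\<^sup>T *\<^sub>v h j"
    have y: "y \<in> carrier_vec k'" using P h(1)[OF j] by (simp add: y_def)
    have uj: "col U j \<in> carrier_vec m" using U jn by auto
    have Wy: "W *\<^sub>v y = U *\<^sub>v x j"
      unfolding W_def using assoc_mult_mat_vec[OF Q(1) P(2) y] fixed[OF j] h(2)[OF j] by (simp add: y_def)
    have "y \<bullet> y = (Q *\<^sub>v (P *\<^sub>v y)) \<bullet> (Q *\<^sub>v (P *\<^sub>v y))"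
      using orthonormal_cols_isometry[OF P(2,3) y] orthonormal_cols_isometry[OF Q, of "P *\<^sub>v y"] P(2) y by simp
    also have "\<dots> = (U *\<^sub>v x j) \<bullet> (U *\<^sub>v x j)" using fixed[OF j] h(2)[OF j] by (simp add: y_def)
    also have "\<dots> = x j \<bullet> x j" by (rule orthonormal_cols_isometry[OF U x(1)[OF j]])
    finally have yy: "y \<bullet> y \<le> \<beta> j" using \<beta>[OF j] by simp
    have "y \<bullet> (W\<^sup>T *\<^sub>v col U j) = (U *\<^sub>v x j) \<bullet> col U j"
      using mult_mat_vec_adjoint[OF W y uj] Wy by simp
    also have "\<dots> = (U\<^sup>T *\<^sub>v (U *\<^sub>v x j)) $ j"
      using U jn x(1)[OF j] comm_scalar_prod[OF uj, of "U *\<^sub>v x j"] by simp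
    also have "\<dots> = 1" using orthonormal_cols_cancel[OF U x(1)[OF j]] x(2)[OF j] by simp
    finally have "1 \<le> (y \<bullet> y) * c j"
      using scalar_prod_cauchy_schwarz[OF y, of "W\<^sup>T *\<^sub>v col U j"] W uj by (simp add: c_def)
    also have "\<dots> \<le> \<beta> j * c j"
      using yy by (intro mult_right_mono) (simp_all add: c_def scalar_prod_self_ge_0)
    finally have 1: "1 \<le> \<beta> j * c j" .
    then have "\<beta> j > 0" using scalar_prod_self_ge_0[of y] yy by (cases "\<beta> j = 0") auto
    then have "1 / \<beta> j \<le> c j" using 1 by (simp add: field_simps)
    then show ?thesis using mult_left_mono[of "1 / \<beta> j" "c j" "(\<sigma> (Suc j))\<^sup>2"] by simp
  qed
  then have "(\<Sum>j<k. (\<sigma> (Suc j))\<^sup>2 / \<beta> j) \<le> (\<Sum>j<k. (\<sigma> (Suc j))\<^sup>2 * c j)" by (intro sum_mono) auto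
  also have "\<dots> \<le> (\<Sum>j<n. (\<sigma> (Suc j))\<^sup>2 * c j)"
    using k by (intro sum_mono2) (auto simp: c_def scalar_prod_self_ge_0)
  also have "\<dots> = frob_sq (W\<^sup>T * A)"
    using frob_sq_svd_compress[OF svd A W] \<open>n \<le> m\<close> by (simp add: c_def min_def)
  also have "\<dots> \<le> (\<Sum>j<k. (\<sigma>\<^sub>B (Suc j))\<^sup>2)"
    unfolding Wt by (rule ky_fan[OF svdB B P(2,3,1) k])
  finally show ?thesis .
qed

text \<open>Here \<open>a\<close>, \<open>b\<close>, \<open>c\<close>, \<open>t\<close> stand for \<open>\<sigma>\<^sub>j\<close>, \<open>\<sigma>\<^sub>s\<^sub>+\<^sub>1\<close>, \<open>\<sigma>\<^sub>k\<close>, \<open>\<sigma>\<^sub>1\<close>. The energy lost at index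
\<open>j\<close> equals \<open>x w / (1 + w x / a\<^sup>2)\<close> with \<open>x = b\<^sup>2 (b / a)\<^bsup>4q\<^esup>\<close>. This expression grows with \<open>x\<close> and
with \<open>a\<close>, so replacing \<open>a\<close> by \<open>c\<close> inside \<open>x\<close> and by \<open>t\<close> in the denominator gives a bound that is
the same for all \<open>j\<close>.\<close>

lemma energy_loss_bound:
  fixes a b c t w :: real
  assumes "0 < c" "c \<le> a" "a \<le> t" "0 \<le> b" "0 \<le> w"
  shows "a\<^sup>2 - (b * (b / c) ^ (2 * q))\<^sup>2 * w / (1 + (b / t * (b / c) ^ (2 * q))\<^sup>2 * w)
    \<le> a\<^sup>2 / (1 + w * (b / a) ^ (2 * (2 * q + 1)))"
proof -
  define x where "x = (b * (b / a) ^ (2 * q))\<^sup>2"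
  define X where "X = (b * (b / c) ^ (2 * q))\<^sup>2"
  have pos: "0 < a" "0 < t" using assms by auto
  have "b / a \<le> b / c" using assms by (intro divide_left_mono) auto
  then have xX: "x \<le> X" unfolding x_def X_def using assms pos
    by (intro power_mono mult_left_mono) auto
  have x0: "0 \<le> x" and X0: "0 \<le> X" by (auto simp: x_def X_def)
  have "x / a\<^sup>2 = (b / a * (b / a) ^ (2 * q))\<^sup>2" by (simp add: x_def power_divide power_mult_distrib)
  also have "\<dots> = ((b / a) ^ (2 * q + 1))\<^sup>2" by simp
  finally have T: "(b / a) ^ (2 * (2 * q + 1)) = x / a\<^sup>2" by (simp only: power_mult[symmetric] mult.commute)
  have G: "(b / t * (b / c) ^ (2 * q))\<^sup>2 = X / t\<^sup>2" by (simp add: X_def power_divide power_mult_distrib)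
  have "a\<^sup>2 - a\<^sup>2 / (1 + w * (x / a\<^sup>2)) = x * w / (1 + w * (x / a\<^sup>2))"
  proof -
    have "1 + w * (x / a\<^sup>2) > 0" using assms x0 by (simp add: add_pos_nonneg)
    then show ?thesis using pos by (simp add: field_simps)
  qed
  also have "\<dots> \<le> x * w / (1 + w * (x / t\<^sup>2))"
  proof -
    have "x / t\<^sup>2 \<le> x / a\<^sup>2" using assms pos x0 by (intro divide_left_mono power_mono) auto
    then have "w * (x / t\<^sup>2) \<le> w * (x / a\<^sup>2)" using assms by (intro mult_left_mono) auto
    then show ?thesis using assms x0 by (intro divide_left_mono mult_pos_pos add_pos_nonneg add_left_mono) auto
  qed
  also have "\<dots> \<le> X * w / (1 + X / t\<^sup>2 * w)"
  proof -
    have p: "1 + w * (x / t\<^sup>2) > 0" "1 + X / t\<^sup>2 * w > 0" using assms x0 X0 by (simp_all add: add_pos_nonneg)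
    have "x * w \<le> X * w" using xX assms by (intro mult_right_mono) auto
    then have "x * w * (1 + X / t\<^sup>2 * w) \<le> X * w * (1 + w * (x / t\<^sup>2))" by (simp add: algebra_simps)
    then show ?thesis using p by (simp add: pos_divide_le_eq pos_le_divide_eq mult.commute[of _ "1 + _"] mult.assoc)
  qed
  finally show ?thesis unfolding T G X_def[symmetric] by linarith
qed

section \<open>Error of the rank-k approximation\<close>

text \<open>Whatever \<open>Q * C\<close> subtracts from \<open>A\<close> lies in the range of \<open>Q\<close>, so projecting that range out
of the error leaves the residual of \<open>A\<close>. Both lower bounds follow, because projections do not
increase lengths.\<close>

lemma residual_of_finer_projection:
  fixes A Q C :: "real mat"
  assumes A: "A \<in> carrier_mat m n" and Q: "Q \<in> carrier_mat m r" "orthonormal_cols Q" and C: "C \<in> carrier_mat r n"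
  defines "E \<equiv> A - Q * C"
  shows "(1\<^sub>m m - Q * Q\<^sup>T) * A = E - Q * (Q\<^sup>T * E)"
proof -
  have Qt: "Q\<^sup>T \<in> carrier_mat r m" and QC: "Q * C \<in> carrier_mat m n"
    and QtA: "Q\<^sup>T * A \<in> carrier_mat r n" and QQA: "Q * (Q\<^sup>T * A) \<in> carrier_mat m n" using Q A C by auto
  have QtQC: "Q\<^sup>T * (Q * C) = C" by (rule orthonormal_cols_cancel_mat[OF Q C])
  have "Q\<^sup>T * E = Q\<^sup>T * A - C" unfolding E_def by (simp only: mult_minus_distrib_mat[OF Qt A QC] QtQC)
  then have "Q * (Q\<^sup>T * E) = Q * (Q\<^sup>T * A) - Q * C" by (simp only: mult_minus_distrib_mat[OF Q(1) QtA C])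
  moreover have "(1\<^sub>m m - Q * Q\<^sup>T) * A = A - Q * (Q\<^sup>T * A)"
    using minus_mult_distrib_mat[of "1\<^sub>m m" m m "Q * Q\<^sup>T" A n] assoc_mult_mat[OF Q(1) Qt A] A Q Qt by simp
  moreover have "A - Q * (Q\<^sup>T * A) = E - (Q * (Q\<^sup>T * A) - Q * C)"
    unfolding E_def by (rule eq_matI) (use A QC QQA in \<open>auto simp del: index_mult_mat(1)\<close>)
  ultimately show ?thesis by simp
qed

theorem theorem4p4:
  fixes A U V \<Omega> \<Omega>\<^sub>1 \<Omega>\<^sub>2 Q B\<^sub>k :: "real mat"
    and \<sigma> :: "nat \<Rightarrow> real"
    and m n k l p q :: nat
    and \<alpha> \<gamma> :: real
  assumes "A \<in> carrier_mat m n"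
    and "m \<ge> n" and "n > max k 2"
    and "vec_space.rank m A = n"
    and "is_svd A U \<sigma> V"
    and "0 < k" and "k \<le> l" and "l < n"
    and "p \<le> l - k"
    and "\<Omega> \<in> carrier_mat n l"
    and "\<Omega>\<^sub>1 \<in> carrier_mat (l - p) l"
    and "\<Omega>\<^sub>2 \<in> carrier_mat (n - l + p) l"
    and "V\<^sup>T * \<Omega> = \<Omega>\<^sub>1 @\<^sub>r \<Omega>\<^sub>2"
    and "vec_space.rank (l - p) \<Omega>\<^sub>1 = l - p"
    and "basic_subspace_iteration A k q \<Omega> Q B\<^sub>k"
    and "\<alpha> = sqrt (real k) * \<sigma> (l - p + 1) * (\<sigma> (l - p + 1) / \<sigma> k) ^ (2 * q)"
    and "\<gamma> = \<sigma> (l - p + 1) / \<sigma> 1 * (\<sigma> (l - p + 1) / \<sigma> k) ^ (2 * q)"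
  shows "frobenius_norm ((1\<^sub>m m - Q * Q\<^sup>T) * A) \<le> frobenius_norm (A - Q * B\<^sub>k)
    \<and> frobenius_norm (A - Q * B\<^sub>k) \<le>
        sqrt ((\<Sum>j = k + 1..n. (\<sigma> j)\<^sup>2) +
          \<alpha>\<^sup>2 * (spectral_norm \<Omega>\<^sub>2)\<^sup>2 * (spectral_norm (pseudo_inverse \<Omega>\<^sub>1))\<^sup>2 /
          (1 + \<gamma>\<^sup>2 * (spectral_norm \<Omega>\<^sub>2)\<^sup>2 * (spectral_norm (pseudo_inverse \<Omega>\<^sub>1))\<^sup>2))
    \<and> spectral_norm ((1\<^sub>m m - Q * Q\<^sup>T) * A) \<le> spectral_norm (A - Q * B\<^sub>k)
    \<and> spectral_norm (A - Q * B\<^sub>k) \<le>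
        sqrt ((\<sigma> (k + 1))\<^sup>2 +
          \<alpha>\<^sup>2 * (spectral_norm \<Omega>\<^sub>2)\<^sup>2 * (spectral_norm (pseudo_inverse \<Omega>\<^sub>1))\<^sup>2 /
          (1 + \<gamma>\<^sup>2 * (spectral_norm \<Omega>\<^sub>2)\<^sup>2 * (spectral_norm (pseudo_inverse \<Omega>\<^sub>1))\<^sup>2))"
proof -
  note A = assms(1) and nm = assms(2) and svd = assms(5)
  define s where "s = l - p"
  define w where "w = (spectral_norm \<Omega>\<^sub>2)\<^sup>2 * (spectral_norm (pseudo_inverse \<Omega>\<^sub>1))\<^sup>2"
  define \<eta> where "\<eta> = \<alpha>\<^sup>2 * w / (1 + \<gamma>\<^sup>2 * w)"
  have w0: "0 \<le> w" by (simp add: w_def)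
  have ks: "k \<le> s" and sn: "s < n" and kn: "k < n" and ns: "n - l + p = n - s" and sl: "l - p + 1 = s + 1"
    using assms(3,6-9) by (auto simp: s_def)
  have U: "U \<in> carrier_mat m n" "orthonormal_cols U"
    and dec: "\<And>i j. 1 \<le> i \<Longrightarrow> i \<le> j \<Longrightarrow> j \<le> n \<Longrightarrow> \<sigma> j \<le> \<sigma> i"
    by (fact is_svdD[OF svd A, unfolded min_absorb2[OF nm]])+
  have pos: "0 < \<sigma> i" if "1 \<le> i" "i \<le> n" for i
    by (rule svd_sigma_pos[OF svd A nm assms(4) that])

  define Y where "Y = (A * A\<^sup>T) ^\<^sub>m q * A * \<Omega>"
  obtain U\<^sub>B \<sigma>\<^sub>B V\<^sub>B where basis: "is_orthonormal_basis_of_col_space Y Q"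
    and svdB: "is_svd (Q\<^sup>T * A) U\<^sub>B \<sigma>\<^sub>B V\<^sub>B"
    and Bk: "B\<^sub>k = first_cols k U\<^sub>B * mat_diag k (\<lambda>i. \<sigma>\<^sub>B (Suc i)) * (first_cols k V\<^sub>B)\<^sup>T"
    using assms(15) unfolding basic_subspace_iteration_def is_truncated_svd_def Y_def by blast
  have Y: "Y \<in> carrier_mat m l"
    unfolding Y_def using A assms(10) by (intro mult_carrier_mat[of _ m n] mult_carrier_mat[of _ m m] pow_carrier_mat) auto
  define r where "r = dim_col Q"
  have Q: "Q \<in> carrier_mat m r" "orthonormal_cols Q" and range: "vec_space.col_space m Q = vec_space.col_space m Y"
    using basis Y by (auto simp: is_orthonormal_basis_of_col_space_def r_def)
  have B: "Q\<^sup>T * A \<in> carrier_mat r n" using Q A by simp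

  \<comment> \<open>\<open>\<beta> j\<close> bounds the squared length of the sketch vector for index \<open>j\<close>; indices start at 0 here.\<close>
  define \<beta> where "\<beta> j = 1 + w * (\<sigma> (s + 1) / \<sigma> (j + 1)) ^ (2 * (2 * q + 1))" for j
  \<comment> \<open>Only the column space of \<open>Q\<close> is known, so each sketch vector has to be rewritten in the basis \<open>Q\<close>.\<close>
  have "\<exists>h x. h \<in> carrier_vec r \<and> x \<in> carrier_vec n \<and> Q *\<^sub>v h = U *\<^sub>v x \<and>
      (\<forall>i<s. x $ i = (if i = j then 1 else 0)) \<and> x \<bullet> x \<le> \<beta> j" if j: "j < s" for j
  proof -
    obtain z x where z: "z \<in> carrier_vec l" and x: "x \<in> carrier_vec n" "Y *\<^sub>v z = U *\<^sub>v x"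
      "\<forall>i<s. x $ i = (if i = j then 1 else 0)" "x \<bullet> x \<le> \<beta> j"
      using sketch_vector_exists[OF svd A nm assms(10) assms(11)[folded s_def] assms(12)[unfolded ns] assms(13) sn
        assms(14)[folded s_def] pos j, of q] unfolding Y_def[symmetric] w_def[symmetric] \<beta>_def by blast
    have "Y *\<^sub>v z \<in> vec_space.col_space m Y"
      using vec_space.col_space_eq[OF Y] Y z by auto
    then obtain h where "h \<in> carrier_vec r" "Q *\<^sub>v h = Y *\<^sub>v z"
      unfolding range[symmetric] vec_space.col_space_eq[OF Q(1)] using Q by auto
    then show ?thesis using x by metis
  qed
  then obtain h x where hx: "\<And>j. j < s \<Longrightarrow> h j \<in> carrier_vec r \<and> x j \<in> carrier_vec n \<and> Q *\<^sub>v h j = U *\<^sub>v x j \<and>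
      (\<forall>i<s. x j $ i = (if i = j then 1 else 0)) \<and> x j \<bullet> x j \<le> \<beta> j"
    by metis
  have "k \<le> r" by (rule range_dim_ge[OF U Q(1), of k x h]) (use hx ks kn in auto)
  then have kr: "k \<le> min r n" using kn by simp

  define E where "E = A - Q * B\<^sub>k"
  define W where "W = first_cols k U\<^sub>B"
  have UB: "U\<^sub>B \<in> carrier_mat r (min r n)" "orthonormal_cols U\<^sub>B"
    by (rule is_svdD[OF svdB B])+
  have W: "W \<in> carrier_mat r k" "orthonormal_cols W"
    unfolding W_def by (rule first_cols_carrier[OF UB(1) kr], rule first_cols_orthonormal[OF UB(1) kr UB(2)])
  have Bk_eq: "B\<^sub>k = W * (W\<^sup>T * (Q\<^sup>T * A))" and Bk_energy: "frob_sq (W\<^sup>T * (Q\<^sup>T * A)) = (\<Sum>i<k. (\<sigma>\<^sub>B (Suc i))\<^sup>2)"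
    using truncated_svd_is_projection[OF svdB B kr] unfolding Bk W_def by auto
  have Z: "W\<^sup>T * (Q\<^sup>T * A) \<in> carrier_mat k n" using W B by simp
  have Bk_carrier: "B\<^sub>k \<in> carrier_mat r n" unfolding Bk_eq using W Z by simp
  have QW: "Q * W \<in> carrier_mat m k" using Q W by simp
  have QB: "Q * B\<^sub>k = (Q * W) * (W\<^sup>T * (Q\<^sup>T * A))"
    unfolding Bk_eq by (rule assoc_mult_mat[OF Q(1) W(1) Z, symmetric])
  have QWt: "(Q * W)\<^sup>T * A = W\<^sup>T * (Q\<^sup>T * A)"
    using transpose_mult[OF Q(1) W(1)] assoc_mult_mat[of "W\<^sup>T" k r "Q\<^sup>T" m A n] W Q A by simp
  have QWo: "orthonormal_cols (Q * W)"
  proof -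
    have "(Q * W)\<^sup>T * (Q * W) = W\<^sup>T * (Q\<^sup>T * (Q * W))"
      unfolding transpose_mult[OF Q(1) W(1)]
      by (rule assoc_mult_mat[OF _ _ QW]) (use W Q in auto)
    also have "Q\<^sup>T * (Q * W) = W" by (rule orthonormal_cols_cancel_mat[OF Q W(1)])
    finally show ?thesis using W QW by (simp add: orthonormal_cols_def)
  qed
  have E: "E \<in> carrier_mat m n" unfolding E_def using Q Bk_carrier by (intro minus_carrier_mat) simp

  have split: "(\<Sum>i<n. (\<sigma> (Suc i))\<^sup>2) = (\<Sum>i<k. (\<sigma> (Suc i))\<^sup>2) + (\<Sum>i=k..<n. (\<sigma> (Suc i))\<^sup>2)"
    using kn by (metis sum.atLeastLessThan_concat lessThan_atLeast0 le0 less_imp_le)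
  have tail: "(\<Sum>i=k..<n. (\<sigma> (Suc i))\<^sup>2) = (\<Sum>j=k+1..n. (\<sigma> j)\<^sup>2)"
    using sum.shift_bounds_Suc_ivl[of "\<lambda>j. (\<sigma> j)\<^sup>2" k n] by (simp add: atLeastLessThanSuc_atLeastAtMost)

  have "(\<Sum>j<k. (\<sigma> (Suc j))\<^sup>2) - \<eta> \<le> (\<Sum>j<k. (\<sigma> (Suc j))\<^sup>2 / \<beta> j)"
  proof -
    \<comment> \<open>\<open>\<delta>\<close> bounds the loss at a single index; the factor \<open>k\<close> in \<open>\<alpha>\<^sup>2\<close> counts the indices.\<close>
    define \<delta> where "\<delta> = (\<sigma> (s + 1) * (\<sigma> (s + 1) / \<sigma> k) ^ (2 * q))\<^sup>2 * w / (1 + \<gamma>\<^sup>2 * w)"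
    have "\<alpha>\<^sup>2 = real k * (\<sigma> (s + 1) * (\<sigma> (s + 1) / \<sigma> k) ^ (2 * q))\<^sup>2"
      unfolding assms(16) sl by (simp add: power_mult_distrib)
    then have "\<eta> = real k * \<delta>" by (simp add: \<eta>_def \<delta>_def)
    moreover have "(\<sigma> (Suc j))\<^sup>2 - \<delta> \<le> (\<sigma> (Suc j))\<^sup>2 / \<beta> j" if j: "j < k" for j
      unfolding \<beta>_def \<delta>_def assms(17) sl Suc_eq_plus1
      using pos[of k] pos[of "s + 1"] assms(6) j kn sn w0
      by (intro energy_loss_bound dec) auto
    then have "(\<Sum>j<k. (\<sigma> (Suc j))\<^sup>2 - \<delta>) \<le> (\<Sum>j<k. (\<sigma> (Suc j))\<^sup>2 / \<beta> j)" by (intro sum_mono) auto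
    ultimately show ?thesis by (simp add: sum_subtractf)
  qed
  also have "\<dots> \<le> (\<Sum>j<k. (\<sigma>\<^sub>B (Suc j))\<^sup>2)"
    by (rule captured_energy_ge[OF svd A nm Q svdB kr, of h x]) (use hx ks in auto)
  finally have energy: "(\<Sum>j<k. (\<sigma> (Suc j))\<^sup>2) - \<eta> \<le> frob_sq (W\<^sup>T * (Q\<^sup>T * A))" by (simp add: Bk_energy)
  have "frob_sq E = frob_sq A - frob_sq (W\<^sup>T * (Q\<^sup>T * A))"
    using frob_sq_residual[OF QW QWo A] by (simp add: QWt E_def QB)
  then have frob: "frob_sq E \<le> (\<Sum>i=k..<n. (\<sigma> (Suc i))\<^sup>2) + \<eta>"
    using energy frob_sq_svd[OF svd A] split nm by (simp add: min_def split: if_splits)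

  have res: "(1\<^sub>m m - Q * Q\<^sup>T) * A = E - Q * (Q\<^sup>T * E)"
    unfolding E_def by (rule residual_of_finer_projection[OF A Q Bk_carrier])
  have 1: "frobenius_norm ((1\<^sub>m m - Q * Q\<^sup>T) * A) \<le> frobenius_norm E"
    unfolding res frobenius_norm_eq_sqrt
    using frob_sq_residual[OF Q E] frob_sq_ge_0[of "Q\<^sup>T * E"] by simp
  have 2: "frobenius_norm E \<le> sqrt ((\<Sum>j=k+1..n. (\<sigma> j)\<^sup>2) + \<eta>)"
    unfolding frobenius_norm_eq_sqrt using frob by (simp add: tail)
  have 3: "spectral_norm ((1\<^sub>m m - Q * Q\<^sup>T) * A) \<le> spectral_norm E"
    unfolding res
  proof (rule spectral_norm_mono)
    show "dim_col (E - Q * (Q\<^sup>T * E)) = dim_col E" by simp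
    fix v :: "real vec" assume "v \<in> carrier_vec (dim_col (E - Q * (Q\<^sup>T * E)))"
    then have v: "v \<in> carrier_vec n" using E by simp
    have QtE: "Q\<^sup>T * E \<in> carrier_mat r n" using Q E by simp
    have "(E - Q * (Q\<^sup>T * E)) *\<^sub>v v = E *\<^sub>v v - Q *\<^sub>v (Q\<^sup>T *\<^sub>v (E *\<^sub>v v))"
      using minus_mult_distrib_mat_vec[OF E mult_carrier_mat[OF Q(1) QtE] v] assoc_mult_mat_vec[OF Q(1) QtE v]
        assoc_mult_mat_vec[of "Q\<^sup>T" r m E n v] Q E v by simp
    then show "((E - Q * (Q\<^sup>T * E)) *\<^sub>v v) \<bullet> ((E - Q * (Q\<^sup>T * E)) *\<^sub>v v) \<le> (E *\<^sub>v v) \<bullet> (E *\<^sub>v v)"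
      using residual_pythagoras[OF Q, of "E *\<^sub>v v"] scalar_prod_self_ge_0[of "Q\<^sup>T *\<^sub>v (E *\<^sub>v v)"] E v by simp
  qed
  have 4: "spectral_norm E \<le> sqrt ((\<sigma> (k + 1))\<^sup>2 + \<eta>)"
  proof (rule spectral_norm_leI)
    fix v :: "real vec" assume "v \<in> carrier_vec (dim_col E)" and v1: "v \<bullet> v \<le> 1"
    then have v: "v \<in> carrier_vec n" using E by simp
    have mn: "min m n = n" using nm by simp
    have "(E *\<^sub>v v) \<bullet> (E *\<^sub>v v) \<le> frob_sq E - (\<Sum>i=Suc k..<n. (\<sigma> (Suc i))\<^sup>2)"
      using low_rank_residual_mult_vec[OF svd A QW Z _ v v1] kn unfolding mn E_def QB by simp
    then show "(E *\<^sub>v v) \<bullet> (E *\<^sub>v v) \<le> (\<sigma> (k + 1))\<^sup>2 + \<eta>"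
      using frob sum.atLeast_Suc_lessThan[OF kn, of "\<lambda>i. (\<sigma> (Suc i))\<^sup>2"] by simp
  qed
  have "\<alpha>\<^sup>2 * (spectral_norm \<Omega>\<^sub>2)\<^sup>2 * (spectral_norm (pseudo_inverse \<Omega>\<^sub>1))\<^sup>2 /
      (1 + \<gamma>\<^sup>2 * (spectral_norm \<Omega>\<^sub>2)\<^sup>2 * (spectral_norm (pseudo_inverse \<Omega>\<^sub>1))\<^sup>2) = \<eta>"
    by (simp add: \<eta>_def w_def mult.assoc)
  then show ?thesis using 1 2 3 4 unfolding E_def by simp
qed

end
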